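(* For every fixed integer $h\ge1$, $$\sup_{k\in\mathbb N}A_{h,k}(x)\ll_h\frac{x}{(\log x)^2}.$$
   Context: $\mathbb N=\{1,2,\ldots\}$; $\sigma(n)=\sum_{d\mid n}d$; for integers $h,k\ge1$, $A_{h,k}(x)=\#\{n\in\mathbb N:n\le x,\ \sigma(n+h)=k\sigma(n)\}$. The notation $f(x)\ll_h g(x)$ means $|f(x)|\le C_h\,g(x)$ for all sufficiently large $x$ (in terms of $h$), with $C_h$ depending only on $h$. *)

theory Defs
  imports Complex_Main "HOL-Library.Landau_Symbols"
begin

definition divisor_sum :: "nat \<Rightarrow> nat"
  where "divisor_sum n = (\<Sum>d | d dvd n. d)"

definition A_set :: "nat \<Rightarrow> nat \<Rightarrow> real \<Rightarrow> nat set"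
  where "A_set h k x =
    {n. n \<ge> 1 \<and> real n \<le> x \<and> divisor_sum (n + h) = k * divisor_sum n}"

definition A_count :: "nat \<Rightarrow> nat \<Rightarrow> real \<Rightarrow> nat"
  where "A_count h k x = card (A_set h k x)"

lemma A_set_subset: "A_set h k x \<subseteq> {1..nat \<lfloor>x\<rfloor>}"
  by (auto simp: A_set_def le_nat_floor)

lemma finite_A_set: "finite (A_set h k x)"
  using A_set_subset by (rule finite_subset) simp

lemma A_count_le: "A_count h k x \<le> nat \<lfloor>x\<rfloor>"
  unfolding A_count_def using card_mono[OF _ A_set_subset[of h k x]] by simp

(* Sup on real has its usual meaning only for nonempty sets that are bounded above. *)
lemma bdd_above_A_count: "bdd_above ((\<lambda>k. real (A_count h k x)) ` K)"
proof (rule bdd_aboveI2)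
  fix k
  show "real (A_count h k x) \<le> real (nat \<lfloor>x\<rfloor>)"
    using A_count_le by (simp only: of_nat_le_iff)
qed

end

theory Submission
  imports
    Defs
    "HOL-Analysis.Harmonic_Numbers"
    "HOL-Computational_Algebra.Computational_Algebra"
    "HOL-Number_Theory.Cong"
    "HOL-Real_Asymp.Real_Asymp"
begin

text \<open>
  Outside a set of size $O(x / (\log x)^2)$, both $n$ and $n + h$ have only $O(\log\log x)$ prime
  factors and no large square divisor. The largest prime power dividing $n$ is then a prime $p$ of
  size at least $x^{1/O(\log\log x)}$, and $p + 1$ divides $\sigma(n) \mid \sigma(n + h)$. Since
  $\sigma(n + h)$ is a product of $O(\log\log x)$ factors $\sigma(q^e)$, some prime $q$ exactly dividing
  $n + h$ shares with $p$ a divisor $d > (\log x)^{12}$ of $p + 1$ and $q + 1$. If $pq \le x (\log x)^4$,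
  summing over $d$, $p$, $q$ shows that there are few such $n$.

  Otherwise write $n = ap$ and $n + h = bq$, so that $ab$ is at most about $x / (\log x)^4$. The equations
  $bq - ap = h$ and $\sigma(b)(q + 1) = k\sigma(a)(p + 1)$ determine $p$ and $q$ from $(a, b)$, unless the
  determinant vanishes, which forces $a = b + h$. In that case $p$ and $q$ are values of two linear
  forms in one variable $t$, and Selberg's sieve bounds the number of such $t$; the resulting bound
  is summable over $b$. All estimates are uniform in $k$.
\<close>

subsection \<open>Selberg's quadratic form\<close>

text \<open>Put \<open>L = ln X\<close>. The parameters are \<open>S\<close> about
  \<open>L^2\<close> and \<open>W\<close> about \<open>3 * log 2 L\<close>, so that sets of size
  \<open>X / S\<close> and \<open>X * L / 2 ^ W\<close> are within the target. The cut at
  \<open>p * q = X * S^2\<close> leaves about \<open>(X / S^2) * L\<close> pairs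
  \<open>(a, b)\<close>; a cut at \<open>X * S\<close> would only give \<open>X / L\<close>.
  Extracting one large factor from a product costs a \<open>W\<close>-th root and happens twice,
  hence the condition \<open>n > S ^ (6 * W^2)\<close>. It is harmless, as the logarithm of the
  right side is of order \<open>(log log X)^3\<close>.

  In the degenerate family the saving of \<open>L^2\<close> has to come from primality. The sieve
  there pays a factor \<open>(1 + ln M)^2\<close> for the primes dividing the coefficients, in place
  of a sharp arithmetic factor. This is affordable: \<open>M\<close> is polynomial in
  \<open>b\<close> while the range of \<open>t\<close> shrinks like \<open>1 / b^2\<close>, so the
  sum over \<open>b\<close> converges. In return the lower bound for Selberg's denominator needs
  nothing beyond the harmonic series. Uniformity in \<open>k\<close> holds because \<open>k\<close>
  enters only as a coefficient of a linear system whose solution is unique, whatever the size of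
  \<open>k\<close>.\<close>

lemma sum_signs_interval:
  assumes "finite F" "E \<subseteq> F"
  shows "(\<Sum>D | E \<subseteq> D \<and> D \<subseteq> F. (-1::real) ^ card D) = (if E = F then (-1) ^ card E else 0)"
proof -
  have finE: "finite E" using assms finite_subset by blast
  have "(\<Sum>D | E \<subseteq> D \<and> D \<subseteq> F. (-1::real) ^ card D) = (\<Sum>D\<in>Pow (F - E). (-1) ^ card (E \<union> D))"
    using assms by (intro sum.reindex_bij_witness[of _ "\<lambda>D. E \<union> D" "\<lambda>D. D - E"])
      (auto simp: Un_absorb1)
  also have "\<dots> = (\<Sum>D\<in>Pow (F - E). (-1) ^ card E * (-1) ^ card D)"
  proof (intro sum.cong refl)
    fix D assume "D \<in> Pow (F - E)"
    then have "card (E \<union> D) = card E + card D"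
      using assms finE by (intro card_Un_disjoint) (auto intro: finite_subset)
    then show "(-1::real) ^ card (E \<union> D) = (-1) ^ card E * (-1) ^ card D"
      by (simp add: power_add)
  qed
  also have "\<dots> = (-1) ^ card E * (\<Sum>D\<in>Pow (F - E). (\<Prod>p\<in>D. -1) * (\<Prod>p\<in>(F - E) - D. 1))"
    by (simp add: sum_distrib_left)
  also have "(\<Sum>D\<in>Pow (F - E). (\<Prod>p\<in>D. -1) * (\<Prod>p\<in>(F - E) - D. 1)) = (\<Prod>p\<in>F - E. -1 + (1::real))"
    using assms by (intro prod_add[symmetric]) auto
  also have "\<dots> = (if E = F then 1 else 0)"
    using assms by (auto simp: prod_zero_iff)
  finally show ?thesis by auto
qed

text \<open>\<open>1 / f p\<close> models the density of the residue classes removed modulo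
  \<open>p\<close>. Squarefree moduli are replaced by sets of primes: lcm and gcd become union and
  intersection, and the level of the sieve becomes a family \<open>\<D>\<close> closed under
  subsets. The condition \<open>f p > 1\<close> says that no prime removes every class and keeps
  \<open>g\<close> positive.\<close>

locale selberg_weights =
  fixes P :: "'a set" and f :: "'a \<Rightarrow> real" and \<D> :: "'a set set"
  assumes finite_P: "finite P"
    and f_gt_1: "\<And>p. p \<in> P \<Longrightarrow> f p > 1"
    and D_subset: "\<D> \<subseteq> Pow P"
    and D_down: "\<And>D E. D \<in> \<D> \<Longrightarrow> E \<subseteq> D \<Longrightarrow> E \<in> \<D>"
    and D_empty: "{} \<in> \<D>"
begin

text \<open>\<open>1 / g\<close> is the Moebius transform of \<open>prod f\<close> over subsets, so
  its values are the coefficients of the diagonalised quadratic form.\<close>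

definition g :: "'a set \<Rightarrow> real"
  where "g D = (\<Prod>p\<in>D. 1 / (f p - 1))"

definition G :: real
  where "G = (\<Sum>E\<in>\<D>. g E)"

text \<open>The minimiser of the quadratic form below among weights with value $1$ at the empty set.\<close>

definition weight :: "'a set \<Rightarrow> real"
  where "weight D = (-1) ^ card D * prod f D / G * (\<Sum>F | F \<in> \<D> \<and> D \<subseteq> F. g F)"

lemma finite_D: "finite \<D>"
  using finite_subset[OF D_subset] finite_P by simp

lemma finite_member: "D \<in> \<D> \<Longrightarrow> finite D"
  using D_subset finite_P finite_subset by blast

lemma g_pos: "D \<in> \<D> \<Longrightarrow> g D > 0"
  unfolding g_def using D_subset f_gt_1 by (intro prod_pos) (fastforce simp: subset_iff)

lemma prod_f_pos: "D \<in> \<D> \<Longrightarrow> prod f D > 0"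
  using D_subset f_gt_1 by (intro prod_pos) (fastforce simp: subset_iff)

lemma g_empty [simp]: "g {} = 1"
  by (simp add: g_def)

lemma G_ge_1: "G \<ge> 1"
proof -
  have "(\<Sum>E\<in>{{}}. g E) \<le> G"
    unfolding G_def using D_empty g_pos finite_D by (intro sum_mono2) (auto intro: less_imp_le)
  then show ?thesis by simp
qed

lemma weight_empty: "weight {} = 1"
proof -
  have "{F. F \<in> \<D> \<and> {} \<subseteq> F} = \<D>" by auto
  then show ?thesis using G_ge_1 by (simp add: weight_def flip: G_def)
qed

text \<open>This separates the variables: the two sets then interact only through their
  intersection, which \<open>prod_f_eq_sum\<close> expands over common subsets.\<close>

lemma prod_f_union:
  assumes "D1 \<in> \<D>" "D2 \<in> \<D>"
  shows "1 / prod f (D1 \<union> D2) = prod f (D1 \<inter> D2) / (prod f D1 * prod f D2)"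
proof -
  have "prod f (D1 \<union> D2) * prod f (D1 \<inter> D2) = prod f D1 * prod f D2"
    using assms finite_member by (intro prod.union_inter) auto
  moreover have "prod f D1 > 0" "prod f D2 > 0" "prod f (D1 \<inter> D2) > 0"
    using assms prod_f_pos D_down[of D1 "D1 \<inter> D2"] by auto
  ultimately show ?thesis
    by (metis (no_types, opaque_lifting) divide_divide_eq_left' divide_self_if less_irrefl mult.commute)
qed

lemma prod_f_eq_sum:
  assumes "D \<in> \<D>"
  shows "prod f D = (\<Sum>E\<in>Pow D. 1 / g E)"
proof -
  have "prod f D = (\<Prod>p\<in>D. (f p - 1) + 1)" by simp
  also have "\<dots> = (\<Sum>E\<in>Pow D. (\<Prod>p\<in>E. f p - 1) * (\<Prod>p\<in>D - E. 1))"
    using finite_member[OF assms] by (rule prod_add)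
  also have "\<dots> = (\<Sum>E\<in>Pow D. 1 / g E)"
    by (simp add: g_def prod_dividef)
  finally show ?thesis .
qed

text \<open>The left side is the diagonal variable at \<open>E\<close>. Inserting the weight and
  exchanging sums leaves a signed sum over the sets between \<open>E\<close> and \<open>F\<close>,
  which vanishes unless \<open>E = F\<close>: Moebius inversion over supersets.\<close>

lemma sum_weight_supersets:
  assumes "E \<in> \<D>"
  shows "(\<Sum>D | D \<in> \<D> \<and> E \<subseteq> D. weight D / prod f D) = (-1) ^ card E * g E / G"
proof -
  have "(\<Sum>D | D \<in> \<D> \<and> E \<subseteq> D. weight D / prod f D)
      = (\<Sum>D | D \<in> \<D> \<and> E \<subseteq> D. \<Sum>F | F \<in> \<D> \<and> D \<subseteq> F. (-1) ^ card D / G * g F)"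
  proof (intro sum.cong refl)
    fix D assume "D \<in> {D. D \<in> \<D> \<and> E \<subseteq> D}"
    then have "prod f D > 0" using prod_f_pos by simp
    then have "weight D / prod f D = (-1) ^ card D / G * (\<Sum>F | F \<in> \<D> \<and> D \<subseteq> F. g F)"
      by (simp add: weight_def)
    then show "weight D / prod f D = (\<Sum>F | F \<in> \<D> \<and> D \<subseteq> F. (-1) ^ card D / G * g F)"
      by (simp only: sum_distrib_left)
  qed
  also have "\<dots> = (\<Sum>F | F \<in> \<D> \<and> E \<subseteq> F. \<Sum>D | E \<subseteq> D \<and> D \<subseteq> F. (-1) ^ card D / G * g F)"
    apply (subst sum.Sigma)
    subgoal using finite_D by auto
    subgoal using finite_D by auto
    apply (subst sum.Sigma)
    subgoal using finite_D by auto
    subgoal using finite_member by (auto intro: rev_finite_subset[of "Pow _"])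
    by (rule sum.reindex_bij_witness[of _ "\<lambda>(x,y). (y,x)" "\<lambda>(x,y). (y,x)"]) (auto intro: D_down)
  also have "\<dots> = (\<Sum>F | F \<in> \<D> \<and> E \<subseteq> F. g F / G * (if E = F then (-1) ^ card E else 0))"
  proof (intro sum.cong refl)
    fix F assume F: "F \<in> {F. F \<in> \<D> \<and> E \<subseteq> F}"
    have "(\<Sum>D | E \<subseteq> D \<and> D \<subseteq> F. (-1) ^ card D / G * g F)
        = g F / G * (\<Sum>D | E \<subseteq> D \<and> D \<subseteq> F. (-1) ^ card D)"
      by (simp add: sum_distrib_left mult_ac)
    then show "(\<Sum>D | E \<subseteq> D \<and> D \<subseteq> F. (-1) ^ card D / G * g F)
        = g F / G * (if E = F then (-1) ^ card E else 0)"
      using F finite_member by (subst (asm) sum_signs_interval) auto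
  qed
  also have "\<dots> = (\<Sum>F\<in>{E}. g F / G * (if E = F then (-1) ^ card E else 0))"
    using assms finite_D by (intro sum.mono_neutral_right) auto
  finally show ?thesis by simp
qed

text \<open>Expanding \<open>prod f (D1 \<inter> D2)\<close> turns the form into the sum over
  \<open>E\<close> of \<open>y E ^ 2 / g E\<close>, where \<open>y E\<close> is the variable of
  \<open>sum_weight_supersets\<close>. As \<open>y E\<close> is \<open>g E / G\<close> up to sign,
  the total is the sum of \<open>g E / G^2\<close>.\<close>

lemma quadratic_form:
  "(\<Sum>D1\<in>\<D>. \<Sum>D2\<in>\<D>. weight D1 * weight D2 / prod f (D1 \<union> D2)) = 1 / G"
proof -
  have "(\<Sum>D1\<in>\<D>. \<Sum>D2\<in>\<D>. weight D1 * weight D2 / prod f (D1 \<union> D2))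
     = (\<Sum>D1\<in>\<D>. \<Sum>D2\<in>\<D>. \<Sum>E\<in>\<D>. if E \<subseteq> D1 \<and> E \<subseteq> D2
          then 1 / g E * (weight D1 / prod f D1) * (weight D2 / prod f D2) else 0)"
  proof (intro sum.cong refl)
    fix D1 D2 assume D: "D1 \<in> \<D>" "D2 \<in> \<D>"
    have I: "D1 \<inter> D2 \<in> \<D>" using D D_down by blast
    have "weight D1 * weight D2 / prod f (D1 \<union> D2) 
        = weight D1 * weight D2 * (prod f (D1 \<inter> D2) / (prod f D1 * prod f D2))"
      using prod_f_union[OF D] by (simp add: divide_inverse)
    also have "\<dots> = (\<Sum>E\<in>Pow (D1 \<inter> D2). 1 / g E * (weight D1 / prod f D1) * (weight D2 / prod f D2))"
      unfolding prod_f_eq_sum[OF I] by (simp add: sum_distrib_left sum_distrib_right sum_divide_distrib mult_ac)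
    also have "\<dots> = (\<Sum>E\<in>\<D>. if E \<subseteq> D1 \<and> E \<subseteq> D2
          then 1 / g E * (weight D1 / prod f D1) * (weight D2 / prod f D2) else 0)"
      using finite_D D D_down by (intro sum.mono_neutral_cong_left) auto
    finally show "weight D1 * weight D2 / prod f (D1 \<union> D2) = \<dots>" .
  qed
  also have "\<dots> = (\<Sum>E\<in>\<D>. \<Sum>D1\<in>\<D>. \<Sum>D2\<in>\<D>. if E \<subseteq> D1 \<and> E \<subseteq> D2
          then 1 / g E * (weight D1 / prod f D1) * (weight D2 / prod f D2) else 0)"
    by (subst sum.swap[of _ \<D> \<D>], rule sum.cong[OF refl], subst sum.swap) (rule refl)
  also have "\<dots> = (\<Sum>E\<in>\<D>. 1 / g E * (\<Sum>D | D \<in> \<D> \<and> E \<subseteq> D. weight D / prod f D)\<^sup>2)"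
  proof (intro sum.cong refl)
    fix E assume "E \<in> \<D>"
    have "(\<Sum>D1\<in>\<D>. \<Sum>D2\<in>\<D>. if E \<subseteq> D1 \<and> E \<subseteq> D2
          then 1 / g E * (weight D1 / prod f D1) * (weight D2 / prod f D2) else 0)
       = (\<Sum>D1\<in>\<D>. \<Sum>D2\<in>\<D>. 1 / g E * (if E \<subseteq> D1 then weight D1 / prod f D1 else 0)
            * (if E \<subseteq> D2 then weight D2 / prod f D2 else 0))"
      by (intro sum.cong) auto
    also have "\<dots> = 1 / g E * (\<Sum>D\<in>\<D>. if E \<subseteq> D then weight D / prod f D else 0)\<^sup>2"
      unfolding power2_eq_square sum_product by (simp only: sum_distrib_left mult.assoc)
    also have "(\<Sum>D\<in>\<D>. if E \<subseteq> D then weight D / prod f D else 0)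
        = (\<Sum>D | D \<in> \<D> \<and> E \<subseteq> D. weight D / prod f D)"
      using finite_D by (simp add: sum.inter_filter)
    finally show "(\<Sum>D1\<in>\<D>. \<Sum>D2\<in>\<D>. if E \<subseteq> D1 \<and> E \<subseteq> D2
          then 1 / g E * (weight D1 / prod f D1) * (weight D2 / prod f D2) else 0)
       = 1 / g E * (\<Sum>D | D \<in> \<D> \<and> E \<subseteq> D. weight D / prod f D)\<^sup>2" .
  qed
  also have "\<dots> = (\<Sum>E\<in>\<D>. g E / G\<^sup>2)"
  proof (intro sum.cong refl)
    fix E assume E: "E \<in> \<D>"
    show "1 / g E * (\<Sum>D | D \<in> \<D> \<and> E \<subseteq> D. weight D / prod f D)\<^sup>2 = g E / G\<^sup>2"
      using g_pos[OF E] unfolding sum_weight_supersets[OF E]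
      by (simp add: power_divide power_mult_distrib power2_eq_square flip: power_mult_distrib)
  qed
  also have "\<dots> = 1 / G"
    using G_ge_1 by (simp add: G_def[symmetric] power2_eq_square flip: sum_divide_distrib)
  finally show ?thesis .
qed

text \<open>For \<open>F\<close> containing \<open>D\<close> one has
  \<open>g F = g D * g (F - D)\<close>, and the sets \<open>F - D\<close> are distinct members of
  \<open>\<D>\<close>. The inner sum of the weight is therefore at most \<open>g D * G\<close>, and
  \<open>G\<close> cancels.\<close>

lemma abs_weight_le:
  assumes D: "D \<in> \<D>"
  shows "\<bar>weight D\<bar> \<le> prod f D * g D"
proof -
  have "(\<Sum>F | F \<in> \<D> \<and> D \<subseteq> F. g F) = (\<Sum>F | F \<in> \<D> \<and> D \<subseteq> F. g D * g (F - D))"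
  proof (intro sum.cong refl)
    fix F assume "F \<in> {F. F \<in> \<D> \<and> D \<subseteq> F}"
    then show "g F = g D * g (F - D)"
      unfolding g_def using finite_member by (subst mult.commute, subst prod.subset_diff) auto
  qed
  also have "\<dots> = g D * (\<Sum>F | F \<in> \<D> \<and> D \<subseteq> F. g (F - D))"
    by (simp add: sum_distrib_left)
  also have "(\<Sum>F | F \<in> \<D> \<and> D \<subseteq> F. g (F - D)) = sum g ((\<lambda>F. F - D) ` {F. F \<in> \<D> \<and> D \<subseteq> F})"
    by (subst sum.reindex) (auto simp: inj_on_def)
  also have "\<dots> \<le> G"
    unfolding G_def using finite_D D_down g_pos
    by (intro sum_mono2) (auto intro: less_imp_le)
  finally have le: "(\<Sum>F | F \<in> \<D> \<and> D \<subseteq> F. g F) \<le> g D * G"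
    using g_pos[OF D] by simp
  have ge: "(\<Sum>F | F \<in> \<D> \<and> D \<subseteq> F. g F) \<ge> 0"
    using g_pos by (intro sum_nonneg) (auto intro: less_imp_le)
  have "\<bar>weight D\<bar> = prod f D / G * (\<Sum>F | F \<in> \<D> \<and> D \<subseteq> F. g F)"
    using G_ge_1 prod_f_pos[OF D] ge by (simp add: weight_def abs_mult power_abs)
  also have "\<dots> \<le> prod f D / G * (g D * G)"
    using G_ge_1 prod_f_pos[OF D] le by (intro mult_left_mono) auto
  also have "\<dots> = prod f D * g D" using G_ge_1 by simp
  finally show ?thesis .
qed

end

subsection \<open>Sums over sets of primes\<close>

lemma sum_inverse_le_ln:
  assumes "n \<ge> 1"
  shows "(\<Sum>k=1..n. 1 / real k) \<le> 1 + ln (real n)"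
proof -
  have "harm n - ln (real n) \<le> harm 1 - ln (real 1)"
    using assms euler_mascheroni_sequence_decreasing[of 1 n] by simp
  then show ?thesis by (simp add: harm_def inverse_eq_divide)
qed

lemma ln_le_sum_inverse:
  assumes "n \<ge> 1"
  shows "ln (real n) \<le> (\<Sum>k=1..n. 1 / real k)"
proof -
  have "ln (real n) \<le> ln (real n + 1)" using assms by simp
  also have "\<dots> \<le> harm n" by (rule ln_le_harm)
  finally show ?thesis by (simp add: harm_def inverse_eq_divide)
qed

lemma sum_inverse_squares_le:
  assumes "S \<ge> 1"
  shows "(\<Sum>k=S..T. 1 / (real k)\<^sup>2) \<le> 2 / real S"
proof (cases "S \<le> T")
  case True
  \<comment> \<open>The term \<open>- 1 / real T\<close> makes the induction telescope.\<close>
  then have "(\<Sum>k=S..T. 1 / (real k)\<^sup>2) \<le> 2 / real S - 1 / real T"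
  proof (induction T rule: dec_induct)
    case base
    have "1 / (real S)\<^sup>2 \<le> 1 / real S"
      using assms by (intro divide_left_mono) (auto simp: power2_eq_square)
    then show ?case by simp
  next
    case (step T)
    have T: "real T > 0" using assms step by simp
    have "1 / (real (Suc T))\<^sup>2 \<le> 1 / (real T * real (Suc T))"
      using T by (intro divide_left_mono) (auto simp: power2_eq_square)
    also have "\<dots> = 1 / real T - 1 / real (Suc T)"
      using T by (simp add: divide_simps)
    finally have "1 / (real (Suc T))\<^sup>2 \<le> 1 / real T - 1 / real (Suc T)" .
    then show ?case using step by simp
  qed
  moreover have "1 / real T \<ge> 0" by simp
  ultimately show ?thesis by linarith
qed auto

text \<open>A squarefree number is represented by the set of its prime factors.\<close>

definition prime_sets :: "nat set \<Rightarrow> nat \<Rightarrow> nat set set"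
  where "prime_sets P z = {D. D \<subseteq> P \<and> \<Prod>D \<le> z}"

lemma prime_factors_Prod:
  assumes "finite D" "\<And>p. p \<in> D \<Longrightarrow> prime (p::nat)"
  shows "prime_factors (\<Prod>D) = D"
proof -
  have "0 \<notin> (\<lambda>x. x) ` D" using assms(2) by force
  then have "prime_factors (\<Prod>D) = (\<Union>p\<in>D. prime_factors p)"
    using assms(1) by (subst prime_factors_prod) auto
  also have "\<dots> = (\<Union>p\<in>D. {p})"
    using assms(2) by (intro SUP_cong refl) (simp add: prime_prime_factors)
  finally show ?thesis by simp
qed

lemma Prod_primes_eq_iff:
  assumes "finite D" "\<And>p. p \<in> D \<Longrightarrow> prime (p::nat)" "finite E" "\<And>p. p \<in> E \<Longrightarrow> prime (p::nat)"
  shows "\<Prod>D = \<Prod>E \<longleftrightarrow> D = E"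
  using prime_factors_Prod[OF assms(1,2)] prime_factors_Prod[OF assms(3,4)] by metis

lemma Prod_primes_pos:
  assumes "\<And>p. p \<in> D \<Longrightarrow> prime (p::nat)"
  shows "\<Prod>D > 0"
  using assms by (intro prod_pos) (auto simp: prime_gt_0_nat)

lemma Prod_primes_dvd_iff:
  assumes "finite D" "\<And>p. p \<in> D \<Longrightarrow> prime (p::nat)"
  shows "\<Prod>D dvd n \<longleftrightarrow> (\<forall>p\<in>D. p dvd n)"
  using assms
proof (induction D rule: finite_induct)
  case (insert p D)
  have "coprime p (\<Prod>D)"
    using insert by (intro prod_coprime_right) (auto intro!: primes_coprime)
  then have "p * \<Prod>D dvd n \<longleftrightarrow> p dvd n \<and> \<Prod>D dvd n"
    by (meson divides_mult dvd_mult_left dvd_mult_right)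
  then show ?case using insert by simp
qed simp

lemma sum_real_le_inject:
  fixes F :: "'b \<Rightarrow> real"
  assumes "inj_on \<phi> A" "\<phi> ` A \<subseteq> B" "finite B"
    and "\<And>x. x \<in> A \<Longrightarrow> f x = F (\<phi> x)" "\<And>y. y \<in> B \<Longrightarrow> F y \<ge> 0"
  shows "sum f A \<le> sum F B"
proof -
  have "sum f A = sum F (\<phi> ` A)"
    using assms by (subst sum.reindex) auto
  also have "\<dots> \<le> sum F B"
    using assms by (intro sum_mono2) auto
  finally show ?thesis .
qed

text \<open>A lower bound for the one-dimensional sieve sum, taken from the harmonic series. The
  factor 2 pays for square parts, and \<open>1 + ln (real M)\<close> for the part of
  \<open>m\<close> built from primes dividing \<open>M\<close>, because that part is a divisor of
  \<open>M\<close>.\<close>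

lemma sum_inverse_le_prime_sets:
  fixes w z M :: nat
  assumes wz: "1 \<le> w" "w \<le> z" and M: "M > 0"
  defines "P \<equiv> {p. prime p \<and> p \<le> z \<and> \<not> p dvd M}"
  shows "ln (real w) \<le> 2 * (1 + ln (real M)) * (\<Sum>D\<in>prime_sets P w. 1 / real (\<Prod>D))"
proof -
  \<comment> \<open>$m = s^2 e \prod D$ where $e$ divides $M$ and $D$ consists of primes not dividing $M$\<close>
  define S where "S = prime_sets P w"
  define F where "F = (\<lambda>(s, e, D). 1 / (real s)\<^sup>2 * (1 / real e * (1 / real (\<Prod>D))))"
  define E where "E = (\<lambda>m. {p \<in> prime_factors (squarefree_part m). p dvd M})"
  define D where "D = (\<lambda>m. {p \<in> prime_factors (squarefree_part m). \<not> p dvd M})"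
  define \<phi> where "\<phi> = (\<lambda>m::nat. (square_part m, \<Prod>(E m), D m))"
  have finP: "finite P" unfolding P_def by simp
  have finS: "finite S" unfolding S_def prime_sets_def using finP by simp
  have decomp: "m = (square_part m)\<^sup>2 * (\<Prod>(E m) * \<Prod>(D m))" if "m > 0" for m
  proof -
    have "\<Prod>(E m) * \<Prod>(D m) = \<Prod>(E m \<union> D m)"
      by (subst prod.union_disjoint) (auto simp: E_def D_def)
    also have "E m \<union> D m = prime_factors (squarefree_part m)" by (auto simp: E_def D_def)
    also have "\<Prod>\<dots> = squarefree_part m"
    proof -
      have "(\<Prod>p\<in>prime_factors (squarefree_part m). p)
          = (\<Prod>p\<in>prime_factors (squarefree_part m). p ^ multiplicity p (squarefree_part m))"
      proof (intro prod.cong refl)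
        fix p assume p: "p \<in> prime_factors (squarefree_part m)"
        then have "multiplicity p (squarefree_part m) \<le> Suc 0"
          by (intro prime_multiplicity_squarefree_part_le_Suc_0) auto
        moreover have "multiplicity p (squarefree_part m) > 0"
          using p by (simp add: prime_factors_multiplicity)
        ultimately have "multiplicity p (squarefree_part m) = 1" by simp
        then show "p = p ^ multiplicity p (squarefree_part m)" by simp
      qed
      also have "\<dots> = squarefree_part m"
        by (rule prime_factorization_nat[symmetric]) (use squarefree_part_nonzero[of m] in blast)
      finally show ?thesis by simp
    qed
    finally show ?thesis using squarefree_decompose[of m] by (simp add: mult.commute)
  qed
  have img: "\<phi> m \<in> {1..w} \<times> {1..M} \<times> S" if "m \<in> {1..w}" for m
  proof -
    have m: "m > 0" "m \<le> w" using that by auto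
    have sp: "square_part m > 0" using m by (metis gr0I square_part_0_iff less_irrefl)
    have dv: "x dvd m \<Longrightarrow> x \<le> w" for x using m dvd_imp_le[of x m] by linarith
    have "square_part m dvd m" using square_part_square_dvd[of m] by (metis dvd_mult_left power2_eq_square)
    then have 1: "square_part m \<in> {1..w}" using sp dv by auto
    have Epos: "\<Prod>(E m) > 0" by (rule Prod_primes_pos) (auto simp: E_def)
    have "\<Prod>(E m) dvd M"
      by (subst Prod_primes_dvd_iff) (auto simp: E_def)
    then have 2: "\<Prod>(E m) \<in> {1..M}" using Epos M dvd_imp_le by (auto simp: Suc_le_eq)
    have dD: "\<Prod>(D m) dvd m" using decomp[OF m(1)] by (metis dvd_triv_right dvd_mult)
    have "D m \<subseteq> P"
    proof
      fix p assume p: "p \<in> D m"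
      then have "p dvd squarefree_part m" "prime p" "\<not> p dvd M" by (auto simp: D_def)
      moreover have "squarefree_part m dvd m" using squarefree_decompose[of m] by (metis dvd_triv_left)
      ultimately show "p \<in> P" using dv[of p] wz unfolding P_def by (auto dest: dvd_trans)
    qed
    then have "D m \<in> S" unfolding S_def prime_sets_def using dv[OF dD] by simp
    with 1 2 show ?thesis by (auto simp: \<phi>_def)
  qed
  have "(\<Sum>m=1..w. 1 / real m) \<le> sum F ({1..w} \<times> {1..M} \<times> S)"
  proof (rule sum_real_le_inject[of \<phi>])
    show "inj_on \<phi> {1..w}"
    proof (rule inj_onI)
      fix m n assume "m \<in> {1..w}" "n \<in> {1..w}" "\<phi> m = \<phi> n"
      then show "m = n" using decomp[of m] decomp[of n] by (simp add: \<phi>_def)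
    qed
    show "\<phi> ` {1..w} \<subseteq> {1..w} \<times> {1..M} \<times> S" using img by blast
    show "finite ({1..w} \<times> {1..M} \<times> S)" using finS by simp
    fix m assume "m \<in> {1..w}"
    then have "m > 0" by simp
    have "1 / real m = 1 / real ((square_part m)\<^sup>2 * (\<Prod>(E m) * \<Prod>(D m)))"
      using decomp[OF \<open>m > 0\<close>] by simp
    also have "\<dots> = F (\<phi> m)"
      by (simp only: F_def \<phi>_def of_nat_mult of_nat_power split: prod.splits) simp
    finally show "1 / real m = F (\<phi> m)" .
  qed (auto simp: F_def simp del: of_nat_prod)
  also have "\<dots> = (\<Sum>s=1..w. 1 / (real s)\<^sup>2) * ((\<Sum>e=1..M. 1 / real e) * (\<Sum>D\<in>S. 1 / real (\<Prod>D)))"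
    unfolding F_def sum_product sum.cartesian_product
    by (intro sum.cong) (auto simp del: of_nat_prod)
  also have "\<dots> \<le> 2 * ((1 + ln (real M)) * (\<Sum>D\<in>S. 1 / real (\<Prod>D)))"
  proof (intro mult_mono)
    show "(\<Sum>s=1..w. 1 / (real s)\<^sup>2) \<le> 2" using sum_inverse_squares_le[of 1 w] by simp
    show "(\<Sum>e=1..M. 1 / real e) \<le> 1 + ln (real M)" using M by (intro sum_inverse_le_ln) simp
  qed (use M in \<open>auto intro!: sum_nonneg mult_nonneg_nonneg simp del: of_nat_prod\<close>)
  finally show ?thesis using ln_le_sum_inverse[of w] wz unfolding S_def by linarith
qed

text \<open>Sieving two linear forms needs a sum with weights \<open>2 ^ card E\<close> of order the
  square of a logarithm; squaring the one-dimensional sum supplies it. The level rises from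
  \<open>w\<close> to \<open>w\<^sup>2\<close>, and the factor 2 is the sum over the products of the
  intersections.\<close>

lemma prime_sets_square:
  fixes w :: nat
  assumes "finite P" and prime: "\<And>p. p \<in> P \<Longrightarrow> prime p"
  shows "(\<Sum>D\<in>prime_sets P w. 1 / real (\<Prod>D))\<^sup>2
    \<le> 2 * (\<Sum>E\<in>prime_sets P (w\<^sup>2). 2 ^ card E / real (\<Prod>E))"
proof -
  \<comment> \<open>A symmetric difference $E$ arises from $2^{|E|}$ pairs for each fixed intersection.\<close>
  define S where "S = prime_sets P w"
  define T where "T = prime_sets P (w\<^sup>2)"
  define F where "F = (\<lambda>(g, E, E1::nat set). 1 / (real g)\<^sup>2 * (1 / real (\<Prod>E)))"
  define \<phi> where "\<phi> = (\<lambda>(D1, D2). (\<Prod>(D1 \<inter> D2), (D1 - D2) \<union> (D2 - D1), D1 - D2 :: nat set))"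
  have finT: "finite T" unfolding T_def prime_sets_def using assms(1) by auto
  have fin: "finite D" if "D \<subseteq> P" for D using that assms(1) finite_subset by blast
  have pos: "\<Prod>D > 0" if "D \<subseteq> P" for D using that prime by (intro Prod_primes_pos) auto
  have split: "\<Prod>D1 * \<Prod>D2 = (\<Prod>(D1 \<inter> D2))\<^sup>2 * \<Prod>((D1 - D2) \<union> (D2 - D1))"
    if "D1 \<subseteq> P" "D2 \<subseteq> P" for D1 D2
  proof -
    have 1: "\<Prod>D1 = \<Prod>(D1 \<inter> D2) * \<Prod>(D1 - D2)"
      using fin[OF that(1)] by (metis Int_Diff_disjoint Int_Diff_Un finite_Diff finite_Int prod.union_disjoint)
    have 2: "\<Prod>D2 = \<Prod>(D1 \<inter> D2) * \<Prod>(D2 - D1)"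
      using fin[OF that(2)] by (metis Int_Diff_disjoint Int_Diff_Un Int_commute finite_Diff finite_Int prod.union_disjoint)
    have 3: "\<Prod>((D1 - D2) \<union> (D2 - D1)) = \<Prod>(D1 - D2) * \<Prod>(D2 - D1)"
      using fin that by (intro prod.union_disjoint) auto
    show ?thesis unfolding 1 2 3 power2_eq_square by (simp only: mult_ac)
  qed
  have mem: "D1 \<subseteq> P" "D2 \<subseteq> P" "\<Prod>D1 \<le> w" "\<Prod>D2 \<le> w" if "(D1, D2) \<in> S \<times> S" for D1 D2
    using that by (auto simp: S_def prime_sets_def)
  have "(\<Sum>D\<in>S. 1 / real (\<Prod>D))\<^sup>2 = (\<Sum>(D1,D2)\<in>S\<times>S. 1 / real (\<Prod>D1) * (1 / real (\<Prod>D2)))"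
    by (simp only: power2_eq_square sum_product sum.cartesian_product)
  also have "\<dots> \<le> sum F ({1..w} \<times> (SIGMA E:T. Pow E))"
  proof (rule sum_real_le_inject[of \<phi>])
    \<comment> \<open>By unique factorisation the product determines \<open>D1 \<inter> D2\<close>;
      the other two components give \<open>D1 - D2\<close> and \<open>D2 - D1\<close>.\<close>
    show "inj_on \<phi> (S \<times> S)"
    proof (rule inj_onI, clarify)
      fix A B C D assume AC: "A \<in> S" "B \<in> S" "C \<in> S" "D \<in> S" and eq: "\<phi> (A, B) = \<phi> (C, D)"
      have sub: "A \<subseteq> P" "B \<subseteq> P" "C \<subseteq> P" "D \<subseteq> P" using AC by (auto simp: S_def prime_sets_def)
      have "\<Prod>(A \<inter> B) = \<Prod>(C \<inter> D)" using eq by (simp add: \<phi>_def)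
      then have "A \<inter> B = C \<inter> D"
        using sub prime fin by (subst (asm) Prod_primes_eq_iff) auto
      moreover have "A - B = C - D" "(A - B) \<union> (B - A) = (C - D) \<union> (D - C)"
        using eq by (auto simp: \<phi>_def)
      ultimately show "A = C \<and> B = D" by blast
    qed
    show "\<phi> ` (S \<times> S) \<subseteq> {1..w} \<times> (SIGMA E:T. Pow E)"
    proof
      fix y assume "y \<in> \<phi> ` (S \<times> S)"
      then obtain D1 D2 where D: "(D1, D2) \<in> S \<times> S" and y: "y = \<phi> (D1, D2)" by auto
      note m = mem[OF D]
      have I: "D1 \<inter> D2 \<subseteq> P" and U: "(D1 - D2) \<union> (D2 - D1) \<subseteq> P" using m by auto
      have "\<Prod>(D1 \<inter> D2) \<le> \<Prod>D1"
        using m fin pos by (intro dvd_imp_le prod_dvd_prod_subset) auto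
      then have 1: "\<Prod>(D1 \<inter> D2) \<in> {1..w}" using pos[OF I] m by (auto simp: Suc_le_eq)
      have "\<Prod>((D1 - D2) \<union> (D2 - D1)) \<le> (\<Prod>(D1 \<inter> D2))\<^sup>2 * \<Prod>((D1 - D2) \<union> (D2 - D1))"
        using pos[OF I] by simp
      also have "\<dots> = \<Prod>D1 * \<Prod>D2" using split m by simp
      also have "\<dots> \<le> w\<^sup>2" unfolding power2_eq_square using m by (intro mult_mono) auto
      finally have "(D1 - D2) \<union> (D2 - D1) \<in> T" using U unfolding T_def prime_sets_def by simp
      then show "y \<in> {1..w} \<times> (SIGMA E:T. Pow E)" using 1 by (auto simp: y \<phi>_def)
    qed
    show "finite ({1..w} \<times> (SIGMA E:T. Pow E))"
      using finT fin by (intro finite_cartesian_product finite_SigmaI) (auto simp: T_def prime_sets_def)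
    fix x assume "x \<in> S \<times> S"
    then obtain D1 D2 where x: "x = (D1, D2)" and D: "(D1, D2) \<in> S \<times> S" by auto
    have "1 / real (\<Prod>D1) * (1 / real (\<Prod>D2)) = 1 / real (\<Prod>D1 * \<Prod>D2)"
      by (simp only: of_nat_mult) simp
    also have "\<dots> = F (\<phi> x)"
      unfolding split[OF mem(1,2)[OF D]] x
      by (simp only: F_def \<phi>_def of_nat_mult of_nat_power split: prod.splits) simp
    finally show "(case x of (D1, D2) \<Rightarrow> 1 / real (\<Prod>D1) * (1 / real (\<Prod>D2))) = F (\<phi> x)"
      by (simp add: x)
  qed (auto simp: F_def simp del: of_nat_prod)
  also have "\<dots> = (\<Sum>g=1..w. 1 / (real g)\<^sup>2) * (\<Sum>(E,E1)\<in>(SIGMA E:T. Pow E). 1 / real (\<Prod>E))"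
    unfolding F_def sum_product sum.cartesian_product
    by (intro sum.cong) (auto simp del: of_nat_prod)
  also have "(\<Sum>(E,E1)\<in>(SIGMA E:T. Pow E). 1 / real (\<Prod>E)) = (\<Sum>E\<in>T. 2 ^ card E / real (\<Prod>E))"
  proof -
    have fE: "finite E" if "E \<in> T" for E using that fin by (auto simp: T_def prime_sets_def)
    have "(\<Sum>(E,E1)\<in>(SIGMA E:T. Pow E). 1 / real (\<Prod>E)) = (\<Sum>E\<in>T. \<Sum>E1\<in>Pow E. 1 / real (\<Prod>E))"
      using finT fE by (subst sum.Sigma) auto
    also have "\<dots> = (\<Sum>E\<in>T. 2 ^ card E / real (\<Prod>E))"
      using fE by (intro sum.cong refl) (simp add: card_Pow del: of_nat_prod)
    finally show ?thesis .
  qed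
  also have "(\<Sum>g=1..w. 1 / (real g)\<^sup>2) * (\<Sum>E\<in>T. 2 ^ card E / real (\<Prod>E))
      \<le> 2 * (\<Sum>E\<in>T. 2 ^ card E / real (\<Prod>E))"
    using sum_inverse_squares_le[of 1 w]
    by (intro mult_right_mono sum_nonneg) (auto simp del: of_nat_prod)
  finally show ?thesis unfolding S_def T_def .
qed

subsection \<open>Simultaneous primality of two linear forms\<close>

lemma card_congruent_le:
  fixes S :: "nat set"
  assumes "S \<subseteq> {1..N}" and "m > 0" and cong: "\<And>s t. s \<in> S \<Longrightarrow> t \<in> S \<Longrightarrow> [s = t] (mod m)"
  shows "card S \<le> N div m + 1"
proof -
  have "inj_on (\<lambda>t. t div m) S"
  proof (rule inj_onI)
    fix s t assume "s \<in> S" "t \<in> S" "s div m = t div m"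
    then show "s = t" using cong[of s t] by (metis unique_euclidean_semiring_class.cong_def div_mult_mod_eq)
  qed
  then have "card S = card ((\<lambda>t. t div m) ` S)" by (simp add: card_image)
  also have "\<dots> \<le> card {0..N div m}"
    using assms(1) by (intro card_mono) (auto intro!: div_le_mono)
  finally show ?thesis by simp
qed

lemma card_congruence_class:
  fixes c m N :: nat
  assumes "m > 0"
  shows "\<bar>real (card {t \<in> {1..N}. [t = c] (mod m)}) - real N / real m\<bar> \<le> 1"
proof -
  let ?S = "{t \<in> {1..N}. [t = c] (mod m)}"
  \<comment> \<open>The representative is taken in \<open>{1..m}\<close> and not in
    \<open>{0..<m}\<close>, so that the progression \<open>i * m + r\<close> starts inside
    \<open>{1..N}\<close>.\<close>
  define r where "r = (if c mod m = 0 then m else c mod m)"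
  have "[m = c] (mod m)" if "c mod m = 0" 
    using that by (metis cong_0_iff cong_sym cong_trans dvd_refl mod_eq_0_iff_dvd)
  moreover have "[c mod m = c] (mod m)" by simp
  ultimately have r2: "[r = c] (mod m)" by (metis r_def)
  have r1: "r \<in> {1..m}"
    using assms mod_less_divisor[of m c] by (simp add: r_def Suc_le_eq less_imp_le)
  note r = r1 r2
  have "card ?S \<le> N div m + 1"
    using assms by (intro card_congruent_le) (auto intro: cong_trans cong_sym)
  moreover have "real (N div m) \<le> real N / real m" by (rule of_nat_div_le_of_nat)
  ultimately have up: "real (card ?S) \<le> real N / real m + 1" by linarith
  have "(\<lambda>i. i * m + r) ` {..<N div m} \<subseteq> ?S"
  proof (rule image_subsetI)
    fix i assume i: "i \<in> {..<N div m}"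
    have "i * m + r \<le> (i + 1) * m" using r by simp
    also have "\<dots> \<le> N div m * m" using i by (intro mult_right_mono) auto
    also have "\<dots> \<le> N" by simp
    finally have "i * m + r \<le> N" .
    moreover have "[i * m + r = c] (mod m)" using r(2) by (simp add: unique_euclidean_semiring_class.cong_def)
    ultimately show "i * m + r \<in> ?S" using r(1) by auto
  qed
  then have "card ((\<lambda>i. i * m + r) ` {..<N div m}) \<le> card ?S" by (intro card_mono) auto
  moreover have "inj_on (\<lambda>i. i * m + r) {..<N div m}" using assms by (auto simp: inj_on_def)
  ultimately have "N div m \<le> card ?S" by (simp add: card_image)
  moreover have "real N / real m < real (N div m) + 1"
  proof -
    have "N < m * (N div m + 1)" using assms by (simp add: dividend_less_times_div)
    then have "real N < real m * (real (N div m) + 1)"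
      by (metis of_nat_1 of_nat_add of_nat_less_iff of_nat_mult)
    then show ?thesis using assms by (simp add: field_simps)
  qed
  ultimately show ?thesis using up by linarith
qed

text \<open>Sort the \<open>t\<close> by the set \<open>E\<close> of primes of \<open>D\<close> that
  divide the first form; the remaining primes must divide the second. A prime dividing both would
  divide \<open>(a - b) * t\<close>, hence \<open>t\<close>, hence 1, so the sorting is disjoint. By
  the Chinese remainder theorem each \<open>E\<close> is a single residue class modulo
  \<open>\<Prod>D\<close>, counted with error at most 1, and there are \<open>2 ^ card D\<close>
  choices of \<open>E\<close>.\<close>

lemma card_roots_two_forms:
  fixes a b N :: nat
  assumes ab: "0 < b" "b < a" and "finite D"
    and D: "\<And>p. p \<in> D \<Longrightarrow> prime p" "\<And>p. p \<in> D \<Longrightarrow> \<not> p dvd a * b * (a - b)"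
  shows "\<bar>real (card {t \<in> {1..N}. \<forall>p\<in>D. p dvd (a * t - 1) * (b * t - 1)})
    - real N * (2 ^ card D / real (\<Prod>D))\<bar> \<le> 2 ^ card D"
proof -
  define A where "A = (\<lambda>E. {t \<in> {1..N}. (\<forall>p\<in>E. p dvd a * t - 1) \<and> (\<forall>p\<in>D - E. p dvd b * t - 1)})"
  have finE: "finite E" if "E \<in> Pow D" for E using that assms(3) finite_subset by blast
  have no_common: False if "p \<in> D" "t \<ge> 1" "p dvd a * t - 1" "p dvd b * t - 1" for p t
  proof -
    have p: "prime p" "\<not> p dvd a - b" using D[OF that(1)] by auto
    have "p dvd (a * t - 1) - (b * t - 1)" by (rule dvd_diff_nat[OF that(3,4)])
    also have "(a * t - 1) - (b * t - 1) = (a - b) * t"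
      using ab that by (simp add: diff_mult_distrib)
    finally have "p dvd t" using p by (auto simp: prime_dvd_mult_iff)
    then have "p dvd a * t" "p dvd a * t - 1" using that by auto
    moreover have "a * t \<ge> 1" using ab that by simp
    ultimately have "p dvd 1" by (metis dvd_diffD1)
    then show False using p by auto
  qed
  have "{t \<in> {1..N}. \<forall>p\<in>D. p dvd (a * t - 1) * (b * t - 1)} = (\<Union>E\<in>Pow D. A E)"
  proof (intro equalityI subsetI)
    fix t assume t: "t \<in> {t \<in> {1..N}. \<forall>p\<in>D. p dvd (a * t - 1) * (b * t - 1)}"
    have "t \<in> A {p \<in> D. p dvd a * t - 1}"
    proof -
      have "p dvd a * t - 1 \<or> p dvd b * t - 1" if "p \<in> D" for p
      proof -
        have "p dvd (a * t - 1) * (b * t - 1)" using t that by simp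
        then show ?thesis by (rule prime_dvd_multD[OF D(1)[OF that]])
      qed
      then have "\<forall>p\<in>D - {p \<in> D. p dvd a * t - 1}. p dvd b * t - 1" by blast
      moreover have "\<forall>p\<in>{p \<in> D. p dvd a * t - 1}. p dvd a * t - 1" by blast
      moreover have "t \<in> {1..N}" using t by blast
      ultimately show ?thesis unfolding A_def by blast
    qed
    then show "t \<in> (\<Union>E\<in>Pow D. A E)" by (rule UN_I[rotated]) simp
  next
    fix t assume "t \<in> (\<Union>E\<in>Pow D. A E)"
    then obtain E where E: "t \<in> A E" by blast
    have "p dvd (a * t - 1) * (b * t - 1)" if "p \<in> D" for p
      using E that unfolding A_def by (cases "p \<in> E") (simp_all add: dvd_mult dvd_mult2)
    then show "t \<in> {t \<in> {1..N}. \<forall>p\<in>D. p dvd (a * t - 1) * (b * t - 1)}"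
      using E by (simp add: A_def)
  qed
  then have "card {t \<in> {1..N}. \<forall>p\<in>D. p dvd (a * t - 1) * (b * t - 1)} = card (\<Union>E\<in>Pow D. A E)"
    by simp
  also have "\<dots> = (\<Sum>E\<in>Pow D. card (A E))"
  proof (intro card_UN_disjoint ballI impI)
    fix E F assume EF: "E \<in> Pow D" "F \<in> Pow D" "E \<noteq> F"
    show "A E \<inter> A F = {}"
    proof (rule ccontr)
      assume "A E \<inter> A F \<noteq> {}"
      then obtain t where t: "t \<in> A E" "t \<in> A F" by blast
      have "E = {p \<in> D. p dvd a * t - 1}" if "E \<in> Pow D" "t \<in> A E" for E
        using that no_common[of _ t] by (auto simp: A_def)
      then show False using EF t by blast
    qed
  qed (use assms(3) in \<open>auto simp: A_def\<close>)
  finally have card: "real (card {t \<in> {1..N}. \<forall>p\<in>D. p dvd (a * t - 1) * (b * t - 1)})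
      = (\<Sum>E\<in>Pow D. real (card (A E)))" by simp
  have AE: "\<bar>real (card (A E)) - real N / real (\<Prod>D)\<bar> \<le> 1" if E: "E \<in> Pow D" for E
  proof -
    have fin: "finite E" "finite (D - E)" using E finE assms(3) by auto
    have pos: "\<Prod>D > 0" using D(1) by (rule Prod_primes_pos)
    have split: "\<Prod>D = \<Prod>E * \<Prod>(D - E)"
      using E assms(3) by (metis PowD mult.commute prod.subset_diff)
    have cop: "coprime (\<Prod>E) (\<Prod>(D - E))"
    proof (intro prod_coprime_left prod_coprime_right)
      fix p q assume "p \<in> E" "q \<in> D - E"
      then have "p \<noteq> q" "prime p" "prime q" using E D(1) by blast+
      then show "coprime p q" by (simp add: primes_coprime)
    qed
    have "coprime a p" "coprime b p" if "p \<in> D" for p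
    proof -
      have "\<not> p dvd a" "\<not> p dvd b" using D(2)[OF that] by auto
      then show "coprime a p" "coprime b p"
        using D(1)[OF that] prime_imp_coprime[of p a] prime_imp_coprime[of p b]
        by (auto simp: coprime_commute)
    qed
    then have copa: "coprime a (\<Prod>E)" "coprime b (\<Prod>(D - E))"
      using E by (auto intro!: prod_coprime_right)
    obtain u where u: "[a * u = 1] (mod \<Prod>E)" using cong_solve_coprime_nat[OF copa(1)] by auto
    obtain v where v: "[b * v = 1] (mod \<Prod>(D - E))" using cong_solve_coprime_nat[OF copa(2)] by auto
    obtain c where c: "[c = u] (mod \<Prod>E)" "[c = v] (mod \<Prod>(D - E))"
      using binary_chinese_remainder_nat[OF cop] by auto
    have "A E = {t \<in> {1..N}. [t = c] (mod \<Prod>D)}"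
      unfolding A_def
    proof (intro Collect_cong conj_cong refl, goal_cases)
      case (1 t)
      then have t: "a * t \<ge> 1" "b * t \<ge> 1" using ab by auto
      have "(\<forall>p\<in>E. p dvd a * t - 1) \<longleftrightarrow> \<Prod>E dvd a * t - 1"
        using E D(1) fin by (subst Prod_primes_dvd_iff) auto
      also have "\<dots> \<longleftrightarrow> [a * t = 1] (mod \<Prod>E)" using t by (simp add: cong_altdef_nat)
      also have "\<dots> \<longleftrightarrow> [a * t = a * u] (mod \<Prod>E)" using u by (meson cong_sym cong_trans)
      also have "\<dots> \<longleftrightarrow> [t = u] (mod \<Prod>E)" using copa(1) by (simp add: cong_mult_lcancel_nat)
      also have "\<dots> \<longleftrightarrow> [t = c] (mod \<Prod>E)" using c by (meson cong_sym cong_trans)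
      finally have e1: "(\<forall>p\<in>E. p dvd a * t - 1) \<longleftrightarrow> [t = c] (mod \<Prod>E)" .
      have "(\<forall>p\<in>D - E. p dvd b * t - 1) \<longleftrightarrow> \<Prod>(D - E) dvd b * t - 1"
        using E D(1) fin by (subst Prod_primes_dvd_iff) auto
      also have "\<dots> \<longleftrightarrow> [b * t = 1] (mod \<Prod>(D - E))" using t by (simp add: cong_altdef_nat)
      also have "\<dots> \<longleftrightarrow> [b * t = b * v] (mod \<Prod>(D - E))" using v by (meson cong_sym cong_trans)
      also have "\<dots> \<longleftrightarrow> [t = v] (mod \<Prod>(D - E))" using copa(2) by (simp add: cong_mult_lcancel_nat)
      also have "\<dots> \<longleftrightarrow> [t = c] (mod \<Prod>(D - E))" using c by (meson cong_sym cong_trans)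
      finally have e2: "(\<forall>p\<in>D - E. p dvd b * t - 1) \<longleftrightarrow> [t = c] (mod \<Prod>(D - E))" .
      have "[t = c] (mod \<Prod>E) \<and> [t = c] (mod \<Prod>(D - E)) \<longleftrightarrow> [t = c] (mod \<Prod>D)"
        unfolding split using cop coprime_cong_mult_nat cong_modulus_mult_nat
        by (metis mult.commute)
      with e1 e2 show ?case by simp
    qed
    then show ?thesis using card_congruence_class[OF pos] by simp
  qed
  have "real N * (2 ^ card D / real (\<Prod>D)) = (\<Sum>E\<in>Pow D. real N / real (\<Prod>D))"
    using assms(3) by (simp add: card_Pow del: of_nat_prod)
  then have "\<bar>real (card {t \<in> {1..N}. \<forall>p\<in>D. p dvd (a * t - 1) * (b * t - 1)})
    - real N * (2 ^ card D / real (\<Prod>D))\<bar> = \<bar>\<Sum>E\<in>Pow D. real (card (A E)) - real N / real (\<Prod>D)\<bar>"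
    by (simp only: card sum_subtractf)
  also have "\<dots> \<le> (\<Sum>E\<in>Pow D. \<bar>real (card (A E)) - real N / real (\<Prod>D)\<bar>)" by (rule sum_abs)
  also have "\<dots> \<le> (\<Sum>E\<in>Pow D. 1)" using AE by (intro sum_mono)
  also have "\<dots> = 2 ^ card D" using assms(3) by (simp add: card_Pow)
  finally show ?thesis .
qed

text \<open>Selberg's sieve of level \<open>w\<^sup>2\<close>, with \<open>w\<close> left free. The
  main term is \<open>N / G\<close>, and the 8 is a factor 4 from squaring the bound for
  \<open>ln w\<close> times the 2 of \<open>prime_sets_square\<close>. The term
  \<open>3 * real w ^ 12\<close> collects the sieve error and the small \<open>t\<close>.\<close>

lemma card_prime_pairs_le:
  fixes a b N w :: nat
  assumes ab: "0 < b" "b < a" and w: "w \<ge> 2"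
  shows "real (card {t \<in> {1..N}. prime (a * t - 1) \<and> prime (b * t - 1)})
    \<le> 8 * (1 + ln (real (2 * (a * b * (a - b)))))\<^sup>2 * real N / (ln (real w))\<^sup>2 + 3 * real w ^ 12"
proof -
  \<comment> \<open>The extra factor 2 keeps the prime 2 out of \<open>P\<close>:
    \<open>f 2 = 1\<close> would violate \<open>f p > 1\<close>.\<close>
  define M where "M = 2 * (a * b * (a - b))"
  define z where "z = w\<^sup>2"
  define P where "P = {p. prime p \<and> p \<le> z \<and> \<not> p dvd M}"
  define \<D> where "\<D> = prime_sets P z"
  \<comment> \<open>For \<open>p\<close> in \<open>P\<close> the two forms vanish on two distinct
    residue classes modulo \<open>p\<close>.\<close>
  define f where "f = (\<lambda>p::nat. real p / 2)"
  define B where "B = (\<lambda>t. {p \<in> P. p dvd (a * t - 1) * (b * t - 1)})"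
  have M: "M > 0" using ab by (simp add: M_def)
  have finP: "finite P" by (simp add: P_def)
  have primeP: "prime p" if "p \<in> P" for p using that by (simp add: P_def)
  have P3: "p \<ge> 3" if "p \<in> P" for p
  proof -
    have "p \<noteq> 2" using that by (auto simp: P_def M_def)
    moreover have "p \<ge> 2" using primeP[OF that] by (rule prime_ge_2_nat)
    ultimately show ?thesis by simp
  qed
  interpret selberg_weights P f \<D>
  proof
    show "finite P" by (rule finP)
    show "f p > 1" if "p \<in> P" for p using P3[OF that] by (simp add: f_def)
    show "\<D> \<subseteq> Pow P" by (auto simp: \<D>_def prime_sets_def)
    show "{} \<in> \<D>" using w by (auto simp: \<D>_def prime_sets_def z_def)
    fix D E assume D: "D \<in> \<D>" and E: "E \<subseteq> D"
    have "D \<subseteq> P" using D by (simp add: \<D>_def prime_sets_def)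
    then have "\<Prod>E \<le> \<Prod>D"
      using E finP primeP by (intro dvd_imp_le prod_dvd_prod_subset Prod_primes_pos) (auto intro: finite_subset)
    then show "E \<in> \<D>" using D E by (auto simp: \<D>_def prime_sets_def)
  qed
  have DP: "D \<subseteq> P" "\<Prod>D \<le> z" if "D \<in> \<D>" for D using that by (auto simp: \<D>_def prime_sets_def)
  have prod_f: "prod f D = real (\<Prod>D) / 2 ^ card D" for D
    by (simp add: f_def prod_dividef)

  have "(\<Sum>E\<in>\<D>. 2 ^ card E / real (\<Prod>E)) \<le> G"
    unfolding G_def
  proof (intro sum_mono)
    fix E assume E: "E \<in> \<D>"
    have "2 ^ card E / real (\<Prod>E) = (\<Prod>p\<in>E. 2 / real p)"
      by (simp add: prod_dividef)
    also have "\<dots> \<le> g E"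
      unfolding g_def
    proof (intro prod_mono conjI)
      fix p assume "p \<in> E"
      then have "p \<ge> 3" using DP[OF E] P3 by blast
      then show "2 / real p \<le> 1 / (f p - 1)" by (simp add: f_def field_simps)
    qed simp
    finally show "2 ^ card E / real (\<Prod>E) \<le> g E" .
  qed
  moreover define H where "H = (\<Sum>D\<in>prime_sets P w. 1 / real (\<Prod>D))"
  moreover have "H\<^sup>2 \<le> 2 * (\<Sum>E\<in>\<D>. 2 ^ card E / real (\<Prod>E))"
    unfolding H_def \<D>_def z_def using finP primeP by (rule prime_sets_square)
  ultimately have HG: "H\<^sup>2 \<le> 2 * G" by linarith
  have "ln (real w) \<le> 2 * (1 + ln (real M)) * H"
    unfolding H_def P_def using w M
    by (intro sum_inverse_le_prime_sets) (auto simp: z_def power2_eq_square)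
  then have "(ln (real w))\<^sup>2 \<le> (2 * (1 + ln (real M)) * H)\<^sup>2"
    using w by (intro power_mono) auto
  also have "\<dots> = 4 * (1 + ln (real M))\<^sup>2 * H\<^sup>2" unfolding power_mult_distrib by simp
  also have "\<dots> \<le> 4 * (1 + ln (real M))\<^sup>2 * (2 * G)" using HG by (intro mult_left_mono) auto
  finally have lnw: "(ln (real w))\<^sup>2 \<le> 8 * (1 + ln (real M))\<^sup>2 * G" by simp
  have "(ln (real w))\<^sup>2 > 0" using w by simp
  moreover have "1 / G \<le> K / Y" if "Y > 0" "Y \<le> K * G" for K Y :: real
    using that G_ge_1 by (simp add: pos_divide_le_eq pos_le_divide_eq)
  ultimately have G_inv: "1 / G \<le> 8 * (1 + ln (real M))\<^sup>2 / (ln (real w))\<^sup>2"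
    using lnw by blast

  \<comment> \<open>Each prime contributes at most \<open>2 * p / (p - 2)\<close>, which is at most
    \<open>p^2\<close> for \<open>p \<ge> 3\<close>. With at most \<open>z\<close> sets in
    \<open>\<D>\<close> the squared error sum is at most \<open>z ^ 6 = w ^ 12\<close>.\<close>
  have weight_bound: "\<bar>weight D\<bar> * 2 ^ card D \<le> real z ^ 2" if D: "D \<in> \<D>" for D
  proof -
    have "\<bar>weight D\<bar> * 2 ^ card D \<le> prod f D * g D * 2 ^ card D"
      using abs_weight_le[OF D] by (intro mult_right_mono) auto
    also have "\<dots> = (\<Prod>p\<in>D. f p * (1 / (f p - 1)) * 2)"
      unfolding g_def by (simp only: prod.distrib prod_constant)
    also have "\<dots> \<le> (\<Prod>p\<in>D. real p ^ 2)"
    proof (intro prod_mono conjI)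
      fix p assume "p \<in> D"
      then have p: "real p \<ge> 3" using DP(1)[OF D] P3[of p] by auto
      then show "0 \<le> f p * (1 / (f p - 1)) * 2" by (simp add: f_def)
      have "3 * 1 \<le> real p * (real p - 2)" using p by (intro mult_mono) auto
      then have "2 \<le> real p * (real p - 2)" by simp
      then have "real p * 2 \<le> real p * (real p * (real p - 2))" using p by (intro mult_left_mono) auto
      then show "f p * (1 / (f p - 1)) * 2 \<le> real p ^ 2"
        using p by (simp add: f_def field_simps power2_eq_square)
    qed
    also have "\<dots> = real (\<Prod>D) ^ 2" by (simp add: prod_power_distrib)
    also have "\<dots> \<le> real z ^ 2" using DP(2)[OF D] by (intro power_mono) (auto simp del: of_nat_prod)
    finally show ?thesis .
  qed
  have "card \<D> \<le> card {1..z}"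
  proof (rule card_inj_on_le[of "\<lambda>D. \<Prod>D"])
    show "inj_on (\<lambda>D. \<Prod>D) \<D>"
    proof (rule inj_onI)
      fix D E assume "D \<in> \<D>" "E \<in> \<D>" "\<Prod>D = \<Prod>E"
      then show "D = E"
        using DP primeP finite_member by (subst (asm) Prod_primes_eq_iff) blast+
    qed
    show "(\<lambda>D. \<Prod>D) ` \<D> \<subseteq> {1..z}"
    proof clarify
      fix D assume D: "D \<in> \<D>"
      have "\<Prod>D > 0" using DP(1)[OF D] primeP by (intro Prod_primes_pos) auto
      then show "\<Prod>D \<in> {1..z}" using DP(2)[OF D] by (simp add: Suc_le_eq)
    qed
  qed simp
  then have "(\<Sum>D\<in>\<D>. \<bar>weight D\<bar> * 2 ^ card D) \<le> real z * real z ^ 2"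
    using weight_bound by (intro order.trans[OF sum_bounded_above]) (auto intro: mult_right_mono)
  then have "(\<Sum>D\<in>\<D>. \<bar>weight D\<bar> * 2 ^ card D)\<^sup>2 \<le> (real z * real z ^ 2)\<^sup>2"
    by (intro power_mono sum_nonneg) auto
  also have "\<dots> = real w ^ 12" by (simp add: z_def flip: power_mult power_add power_Suc)
  finally have err: "(\<Sum>D\<in>\<D>. \<bar>weight D\<bar> * 2 ^ card D)\<^sup>2 \<le> real w ^ 12" .

  \<comment> \<open>Selberg's majorant is \<open>(\<nu> t)\<^sup>2\<close>: it is nonnegative, and
    equals 1 when no prime of \<open>P\<close> divides the value at \<open>t\<close>.\<close>
  define \<nu> where "\<nu> = (\<lambda>t. \<Sum>D\<in>\<D>. if D \<subseteq> B t then weight D else 0)"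
  define c where "c = (\<lambda>D. real (card {t \<in> {1..N}. D \<subseteq> B t}))"
  have c: "\<bar>c (D1 \<union> D2) - real N / prod f (D1 \<union> D2)\<bar> \<le> 2 ^ card D1 * 2 ^ card D2"
    if D: "D1 \<in> \<D>" "D2 \<in> \<D>" for D1 D2
  proof -
    have sub: "D1 \<union> D2 \<subseteq> P" using DP(1) D by auto
    have "{t \<in> {1..N}. D1 \<union> D2 \<subseteq> B t}
        = {t \<in> {1..N}. \<forall>p\<in>D1 \<union> D2. p dvd (a * t - 1) * (b * t - 1)}"
      using sub by (auto simp: B_def)
    moreover have "\<not> p dvd a * b * (a - b)" if "p \<in> D1 \<union> D2" for p
      using that sub by (auto simp: P_def M_def)
    ultimately have "\<bar>c (D1 \<union> D2) - real N * (2 ^ card (D1 \<union> D2) / real (\<Prod>(D1 \<union> D2)))\<bar> \<le> 2 ^ card (D1 \<union> D2)"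
      unfolding c_def
      using card_roots_two_forms[OF ab, of "D1 \<union> D2" N] sub primeP finite_subset[OF sub finP]
      by (simp only:) blast
    also have "\<dots> \<le> 2 ^ (card D1 + card D2)"
      by (intro power_increasing card_Un_le) auto
    finally show ?thesis by (simp add: prod_f power_add del: of_nat_prod)
  qed
  have "(\<Sum>t=1..N. (\<nu> t)\<^sup>2) = (\<Sum>t=1..N. \<Sum>D1\<in>\<D>. \<Sum>D2\<in>\<D>.
      weight D1 * weight D2 * (if D1 \<union> D2 \<subseteq> B t then 1 else 0))"
    unfolding \<nu>_def power2_eq_square sum_product by (intro sum.cong refl) auto
  also have "\<dots> = (\<Sum>D1\<in>\<D>. \<Sum>D2\<in>\<D>. \<Sum>t=1..N.
      weight D1 * weight D2 * (if D1 \<union> D2 \<subseteq> B t then 1 else 0))"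
    by (subst sum.swap, rule sum.cong[OF refl], subst sum.swap) (rule refl)
  also have "\<dots> = (\<Sum>D1\<in>\<D>. \<Sum>D2\<in>\<D>. weight D1 * weight D2 * c (D1 \<union> D2))"
    by (simp add: c_def sum.If_cases Int_def flip: sum_distrib_left)
  also have "\<dots> = (\<Sum>D1\<in>\<D>. \<Sum>D2\<in>\<D>. real N * (weight D1 * weight D2 / prod f (D1 \<union> D2)))
      + (\<Sum>D1\<in>\<D>. \<Sum>D2\<in>\<D>. weight D1 * weight D2 * (c (D1 \<union> D2) - real N / prod f (D1 \<union> D2)))"
    unfolding sum.distrib[symmetric] by (intro sum.cong refl) (simp add: algebra_simps)
  also have "(\<Sum>D1\<in>\<D>. \<Sum>D2\<in>\<D>. real N * (weight D1 * weight D2 / prod f (D1 \<union> D2))) = real N * (1 / G)"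
    unfolding quadratic_form[symmetric] by (simp only: sum_distrib_left)
  also have "(\<Sum>D1\<in>\<D>. \<Sum>D2\<in>\<D>. weight D1 * weight D2 * (c (D1 \<union> D2) - real N / prod f (D1 \<union> D2)))
      \<le> (\<Sum>D1\<in>\<D>. \<Sum>D2\<in>\<D>. (\<bar>weight D1\<bar> * 2 ^ card D1) * (\<bar>weight D2\<bar> * 2 ^ card D2))"
  proof (intro sum_mono)
    fix D1 D2 assume D: "D1 \<in> \<D>" "D2 \<in> \<D>"
    have "weight D1 * weight D2 * (c (D1 \<union> D2) - real N / prod f (D1 \<union> D2))
        \<le> \<bar>weight D1 * weight D2\<bar> * \<bar>c (D1 \<union> D2) - real N / prod f (D1 \<union> D2)\<bar>"
      by (metis abs_ge_self abs_mult)
    also have "\<dots> \<le> \<bar>weight D1 * weight D2\<bar> * (2 ^ card D1 * 2 ^ card D2)"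
      using c[OF D] by (intro mult_left_mono) auto
    finally show "weight D1 * weight D2 * (c (D1 \<union> D2) - real N / prod f (D1 \<union> D2))
        \<le> (\<bar>weight D1\<bar> * 2 ^ card D1) * (\<bar>weight D2\<bar> * 2 ^ card D2)"
      by (simp add: abs_mult mult_ac)
  qed
  also have "\<dots> = (\<Sum>D\<in>\<D>. \<bar>weight D\<bar> * 2 ^ card D)\<^sup>2"
    by (simp add: power2_eq_square sum_product)
  also have "\<dots> \<le> real w ^ 12" by (rule err)
  finally have nu: "(\<Sum>t=1..N. (\<nu> t)\<^sup>2) \<le> real N * (1 / G) + real w ^ 12" by simp

  \<comment> \<open>A prime value can itself belong to \<open>P\<close>, in which case
    \<open>t\<close> is not sifted. Such a value is at most \<open>z\<close>, which forces
    \<open>t \<le> z + 1\<close>.\<close>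
  have "card {t \<in> {1..N}. prime (a * t - 1) \<and> prime (b * t - 1)}
      \<le> card ({1..z + 1} \<union> {t \<in> {1..N}. B t = {}})"
  proof (intro card_mono subsetI)
    fix t assume t: "t \<in> {t \<in> {1..N}. prime (a * t - 1) \<and> prime (b * t - 1)}"
    show "t \<in> {1..z + 1} \<union> {t \<in> {1..N}. B t = {}}"
    proof (cases "t \<le> z + 1")
      case False
      have "t \<le> b * t" "t \<le> a * t" using ab by auto
      then have big: "a * t - 1 > z" "b * t - 1 > z" using False by linarith+
      have "B t = {}"
      proof (rule ccontr)
        assume "B t \<noteq> {}"
        then obtain p where p: "prime p" "p \<le> z" "p dvd (a * t - 1) * (b * t - 1)"
          by (auto simp: B_def P_def)
        then have "p dvd a * t - 1 \<or> p dvd b * t - 1" by (simp add: prime_dvd_mult_iff)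
        then have "p = a * t - 1 \<or> p = b * t - 1" using t p(1) primes_dvd_imp_eq by auto
        then show False using big p by auto
      qed
      then show ?thesis using t by auto
    qed (use t in auto)
  qed simp
  also have "\<dots> \<le> card {1..z + 1} + card {t \<in> {1..N}. B t = {}}" by (rule card_Un_le)
  finally have "real (card {t \<in> {1..N}. prime (a * t - 1) \<and> prime (b * t - 1)})
      \<le> real z + 1 + real (card {t \<in> {1..N}. B t = {}})" by simp
  also have "real (card {t \<in> {1..N}. B t = {}}) = (\<Sum>t\<in>{t \<in> {1..N}. B t = {}}. (\<nu> t)\<^sup>2)"
  proof -
    have "(\<nu> t)\<^sup>2 = 1" if "B t = {}" for t
    proof -
      have "\<nu> t = (\<Sum>D\<in>{{}}. weight D)"
        unfolding \<nu>_def using that finite_D D_empty by (intro sum.mono_neutral_cong_right) auto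
      then show ?thesis using weight_empty by simp
    qed
    then show ?thesis by simp
  qed
  also have "\<dots> \<le> (\<Sum>t=1..N. (\<nu> t)\<^sup>2)" by (intro sum_mono2) auto
  also note nu
  also have "real N * (1 / G) \<le> real N * (8 * (1 + ln (real M))\<^sup>2 / (ln (real w))\<^sup>2)"
    using G_inv by (intro mult_left_mono) auto
  also have "real z + 1 + (real N * (8 * (1 + ln (real M))\<^sup>2 / (ln (real w))\<^sup>2) + real w ^ 12)
     \<le> 8 * (1 + ln (real M))\<^sup>2 * real N / (ln (real w))\<^sup>2 + 3 * real w ^ 12"
  proof -
    have "real z = real w ^ 2" by (simp add: z_def)
    also have "\<dots> \<le> real w ^ 12" using w by (intro power_increasing) auto
    finally have "real z \<le> real w ^ 12" .
    moreover have "1 \<le> real w ^ 12" using w by simp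
    moreover have "real N * (8 * (1 + ln (real M))\<^sup>2 / (ln (real w))\<^sup>2)
        = 8 * (1 + ln (real M))\<^sup>2 * real N / (ln (real w))\<^sup>2" by simp
    ultimately show ?thesis by linarith
  qed
  finally show ?thesis by (simp only: M_def add.assoc)
qed

text \<open>Take \<open>w\<close> as the floor of \<open>N powr (1/16)\<close>: then
  \<open>w ^ 12\<close> is at most \<open>N powr (3/4)\<close>, below
  \<open>N / (ln N)\<^sup>2\<close>, and \<open>ln w\<close> is at least \<open>ln N / 32\<close>
  after rounding. The constant is \<open>8 * 32^2 = 8192\<close>, plus 1 for the error term.\<close>

lemma card_prime_pairs_asymp:
  "\<exists>C N0. C > 0 \<and> (\<forall>N a b. N0 \<le> N \<longrightarrow> 0 < b \<longrightarrow> b < a \<longrightarrow>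
     real (card {t \<in> {1..N}. prime (a * t - 1) \<and> prime (b * t - 1)})
       \<le> C * (1 + ln (real (2 * (a * b * (a - b)))))\<^sup>2 * real N / (ln (real N))\<^sup>2)"
proof -
  have "\<forall>\<^sub>F x::real in at_top. 3 * (x powr (1/16)) ^ 12 \<le> x / (ln x)\<^sup>2"
    by real_asymp
  moreover have "\<forall>\<^sub>F x::real in at_top. ln (x powr (1/16) - 1) \<ge> ln x / 32" by real_asymp
  moreover have "\<forall>\<^sub>F x::real in at_top. x powr (1/16) - 1 \<ge> 2" by real_asymp
  moreover have "\<forall>\<^sub>F x::real in at_top. ln x \<ge> 1" by real_asymp
  ultimately have "\<forall>\<^sub>F x::real in at_top. 3 * (x powr (1/16)) ^ 12 \<le> x / (ln x)\<^sup>2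
      \<and> ln (x powr (1/16) - 1) \<ge> ln x / 32 \<and> x powr (1/16) - 1 \<ge> 2 \<and> ln x \<ge> 1"
    by eventually_elim simp
  from eventually_compose_filterlim[OF this filterlim_real_sequentially]
  have "\<forall>\<^sub>F N in sequentially. 3 * (real N powr (1/16)) ^ 12 \<le> real N / (ln (real N))\<^sup>2
      \<and> ln (real N powr (1/16) - 1) \<ge> ln (real N) / 32 \<and> real N powr (1/16) - 1 \<ge> 2 \<and> ln (real N) \<ge> 1"
    by simp
  then obtain N0 where N0: "\<And>N. N \<ge> N0 \<Longrightarrow> 3 * (real N powr (1/16)) ^ 12 \<le> real N / (ln (real N))\<^sup>2
      \<and> ln (real N powr (1/16) - 1) \<ge> ln (real N) / 32 \<and> real N powr (1/16) - 1 \<ge> 2 \<and> ln (real N) \<ge> 1"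
    unfolding eventually_sequentially by blast
  have "real (card {t \<in> {1..N}. prime (a * t - 1) \<and> prime (b * t - 1)})
       \<le> 8193 * (1 + ln (real (2 * (a * b * (a - b)))))\<^sup>2 * real N / (ln (real N))\<^sup>2"
    if N: "N \<ge> N0" and ab: "0 < b" "b < a" for N a b
  proof -
    define w where "w = nat \<lfloor>real N powr (1/16)\<rfloor>"
    define K where "K = (1 + ln (real (2 * (a * b * (a - b)))))\<^sup>2"
    have lnN: "ln (real N) \<ge> 1" using N0[OF N] by simp
    have w_ge: "real w \<ge> real N powr (1/16) - 1" unfolding w_def by linarith
    have w_le: "real w \<le> real N powr (1/16)" unfolding w_def using powr_ge_zero[of "real N" "1/16"] by linarith
    have w2: "w \<ge> 2" using w_ge N0[OF N] by linarith
    have "2 * (a * b * (a - b)) \<ge> 1" using ab by (simp add: Suc_le_eq)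
    then have "real (2 * (a * b * (a - b))) \<ge> 1" by (simp only: real_of_nat_ge_one_iff)
    then have "ln (real (2 * (a * b * (a - b)))) \<ge> 0" by (rule ln_ge_zero)
    then have K1: "K \<ge> 1" unfolding K_def by (intro one_le_power) linarith
    have "ln (real w) \<ge> ln (real N powr (1/16) - 1)"
      using w_ge N0[OF N] by (intro ln_mono) auto
    then have lnw: "ln (real w) \<ge> ln (real N) / 32" using N0[OF N] by linarith
    then have "(ln (real N) / 32)\<^sup>2 \<le> (ln (real w))\<^sup>2" using lnN by (intro power_mono) auto
    then have "8 * K * real N / (ln (real w))\<^sup>2 \<le> 8 * K * real N / (ln (real N) / 32)\<^sup>2"
      using lnN K1 by (intro divide_left_mono mult_nonneg_nonneg) (auto intro!: mult_pos_pos)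
    also have "\<dots> = 8192 * K * real N / (ln (real N))\<^sup>2"
      using lnN by (simp add: power_divide)
    finally have 1: "8 * K * real N / (ln (real w))\<^sup>2 \<le> 8192 * K * real N / (ln (real N))\<^sup>2" .
    have "3 * real w ^ 12 \<le> 3 * (real N powr (1/16)) ^ 12"
      using w_le by (intro mult_left_mono power_mono) auto
    also have "\<dots> \<le> real N / (ln (real N))\<^sup>2" using N0[OF N] by simp
    also have "\<dots> \<le> K * (real N / (ln (real N))\<^sup>2)"
      using mult_right_mono[OF K1, of "real N / (ln (real N))\<^sup>2"] by simp
    finally have 2: "3 * real w ^ 12 \<le> K * (real N / (ln (real N))\<^sup>2)" .
    have "real (card {t \<in> {1..N}. prime (a * t - 1) \<and> prime (b * t - 1)})
        \<le> 8 * K * real N / (ln (real w))\<^sup>2 + 3 * real w ^ 12"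
      unfolding K_def by (rule card_prime_pairs_le[OF ab w2])
    also have "\<dots> \<le> 8192 * K * real N / (ln (real N))\<^sup>2 + K * (real N / (ln (real N))\<^sup>2)"
      using 1 2 by (rule add_mono)
    also have "\<dots> = 8193 * K * real N / (ln (real N))\<^sup>2" by simp
    finally show ?thesis unfolding K_def .
  qed
  then show ?thesis by (intro exI[of _ 8193] exI[of _ N0]) auto
qed

subsection \<open>Shifted primes with a large common divisor\<close>

lemma divisor_sum_pos:
  assumes "n > 0"
  shows "divisor_sum n > 0"
proof -
  have "sum (\<lambda>d. d) {n} \<le> sum (\<lambda>d. d) {d. d dvd n}"
    using assms by (intro sum_mono2) simp_all
  then show ?thesis using assms unfolding divisor_sum_def by simp
qed

lemma divisor_sum_le_square: "divisor_sum n \<le> n ^ 2" if "n > 0"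
proof -
  have "{d. d dvd n} \<subseteq> {1..n}"
  proof
    fix d assume "d \<in> {d. d dvd n}"
    then have "d dvd n" by simp
    from dvd_imp_le[OF this that] dvd_pos_nat[OF that this] show "d \<in> {1..n}" by simp
  qed
  then have "divisor_sum n \<le> (\<Sum>d=1..n. d)"
    unfolding divisor_sum_def by (intro sum_mono2) auto
  also have "\<dots> \<le> (\<Sum>d=1..n. n)" by (intro sum_mono) simp
  finally have "divisor_sum n \<le> (\<Sum>d=1..n. n)" .
  then show ?thesis by (simp add: power2_eq_square)
qed

lemma divisor_sum_mult_coprime:
  assumes "coprime a b"
  shows "divisor_sum (a * b) = divisor_sum a * divisor_sum b"
proof (cases "a = 0 \<or> b = 0")
  case False
  have "divisor_sum a * divisor_sum b = (\<Sum>(d, e)\<in>{d. d dvd a} \<times> {e. e dvd b}. d * e)"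
    by (simp add: divisor_sum_def sum_product sum.cartesian_product)
  also have "\<dots> = (\<Sum>d | d dvd a * b. d)"
  proof (rule sum.reindex_bij_witness[of _ "\<lambda>x. (gcd x a, gcd x b)" "\<lambda>(d, e). d * e"])
    fix y assume "y \<in> {d. d dvd a} \<times> {e. e dvd b}"
    then obtain d e where y: "y = (d, e)" "d dvd a" "e dvd b" by auto
    have "coprime a e" "coprime b d" using y assms
      by (auto intro: coprime_divisors[of _ a _ b] coprime_divisors[of _ b _ a] simp: coprime_commute)
    then have "gcd (d * e) a = d" "gcd (d * e) b = e"
      using y by (simp_all add: gcd_mult_left_right_cancel gcd_mult_left_left_cancel gcd_nat.absorb1)
    then show "(gcd (case y of (d, e) \<Rightarrow> d * e) a, gcd (case y of (d, e) \<Rightarrow> d * e) b) = y"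
      by (simp add: y)
  next
    fix x assume "x \<in> {d. d dvd a * b}"
    then obtain d e where x: "x = d * e" "d dvd a" "e dvd b"
      using division_decomp[of x a b] by auto
    have "coprime a e" "coprime b d" using x assms
      by (auto intro: coprime_divisors[of _ a _ b] coprime_divisors[of _ b _ a] simp: coprime_commute)
    then have "gcd (d * e) a = d" "gcd (d * e) b = e"
      using x by (simp_all add: gcd_mult_left_right_cancel gcd_mult_left_left_cancel gcd_nat.absorb1)
    then show "(case (gcd x a, gcd x b) of (d, e) \<Rightarrow> d * e) = x" by (simp add: x)
  qed (auto intro: mult_dvd_mono)
  finally show ?thesis by (simp add: divisor_sum_def)
qed (use assms in \<open>auto simp: divisor_sum_def\<close>)

lemma divisor_sum_prime: "prime p \<Longrightarrow> divisor_sum p = p + 1"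
proof -
  assume p: "prime p"
  have "d dvd p \<longleftrightarrow> d = 1 \<or> d = p" for d
    using p prime_nat_iff by (metis dvd_refl one_dvd)
  then have "{d. d dvd p} = {1, p}" by blast
  then show ?thesis using prime_gt_1_nat[OF p] by (simp add: divisor_sum_def)
qed

lemma divisor_sum_prod_coprime:
  assumes "finite I" "\<And>i j. i \<in> I \<Longrightarrow> j \<in> I \<Longrightarrow> i \<noteq> j \<Longrightarrow> coprime (s i) (s j)"
  shows "divisor_sum (\<Prod>i\<in>I. s i) = (\<Prod>i\<in>I. divisor_sum (s i))"
  using assms
proof (induction I rule: finite_induct)
  case empty
  then show ?case by (simp add: divisor_sum_def)
next
  case (insert i I)
  then have "coprime (s i) (\<Prod>i\<in>I. s i)" by (intro prod_coprime_right) auto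
  then show ?case using insert by (simp add: divisor_sum_mult_coprime)
qed

lemma divisor_sum_prime_factors:
  assumes "n > 0"
  shows "divisor_sum n = (\<Prod>p\<in>prime_factors n. divisor_sum (p ^ multiplicity p n))"
proof -
  have "divisor_sum n = divisor_sum (\<Prod>p\<in>prime_factors n. p ^ multiplicity p n)"
    using prime_factorization_nat[OF assms] by simp
  also have "\<dots> = (\<Prod>p\<in>prime_factors n. divisor_sum (p ^ multiplicity p n))"
  proof (rule divisor_sum_prod_coprime)
    fix p q assume "p \<in> prime_factors n" "q \<in> prime_factors n" "p \<noteq> q"
    then have "coprime p q" by (intro primes_coprime) auto
    then show "coprime (p ^ multiplicity p n) (q ^ multiplicity q n)" by simp
  qed simp
  finally show ?thesis .
qed

section \<open>One large common factor from a divisor of a product\<close>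

lemma gcd_mult_dvd_mult_gcd: "gcd m (x * y) dvd gcd m x * gcd m (y::nat)"
proof -
  obtain d e where de: "gcd m (x * y) = d * e" "d dvd x" "e dvd y"
    using division_decomp[OF gcd_dvd2] by blast
  then have "d * e dvd m" by (metis gcd_dvd1)
  then have "d dvd m" "e dvd m" by (auto dest: dvd_mult_left dvd_mult_right)
  then show ?thesis unfolding de(1) using de by (intro mult_dvd_mono gcd_greatest)
qed

text \<open>Since \<open>gcd m\<close> is submultiplicative, \<open>m\<close> is at most the product
  of the gcds, and the largest of them has a power at least \<open>m\<close>. It serves twice: to
  find a large prime power in \<open>n\<close>, and to find a prime power of the shifted number
  whose divisor sum shares much with \<open>p + 1\<close>.\<close>

lemma exists_large_gcd:
  fixes m :: nat and s :: "'b \<Rightarrow> nat"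
  assumes "finite I" "m dvd (\<Prod>i\<in>I. s i)" "m > 1"
  shows "\<exists>i\<in>I. m \<le> gcd m (s i) ^ card I"
proof (rule ccontr)
  assume neg: "\<not> (\<exists>i\<in>I. m \<le> gcd m (s i) ^ card I)"
  have "gcd m (\<Prod>i\<in>I. s i) dvd (\<Prod>i\<in>I. gcd m (s i))"
    using assms(1)
  proof (induction I rule: finite_induct)
    case (insert i I)
    have "gcd m (s i * (\<Prod>i\<in>I. s i)) dvd gcd m (s i) * gcd m (\<Prod>i\<in>I. s i)"
      by (rule gcd_mult_dvd_mult_gcd)
    also have "\<dots> dvd gcd m (s i) * (\<Prod>i\<in>I. gcd m (s i))"
      by (intro mult_dvd_mono insert.IH dvd_refl)
    finally show ?case using insert by simp
  qed simp
  then have "m dvd (\<Prod>i\<in>I. gcd m (s i))" using assms(2) by (simp add: gcd_nat.absorb1)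
  then have m_le: "m \<le> (\<Prod>i\<in>I. gcd m (s i))"
    using assms by (intro dvd_imp_le prod_pos) auto
  have ne: "I \<noteq> {}" using m_le assms(3) by auto
  define D where "D = Max ((\<lambda>i. gcd m (s i)) ` I)"
  have "D \<in> (\<lambda>i. gcd m (s i)) ` I" unfolding D_def using assms(1) ne by (intro Max_in) auto
  then have "D ^ card I < m" using neg by fastforce
  moreover have "(\<Prod>i\<in>I. gcd m (s i)) \<le> (\<Prod>i\<in>I. D)"
    using assms(1) by (intro prod_mono) (auto simp: D_def)
  ultimately show False using m_le by simp
qed

text \<open>For \<open>e \<ge> 2\<close> the square of \<open>p ^ (e div 2)\<close> divides
  \<open>n\<close>, so this power is below \<open>S\<close>, and
  \<open>e \<le> 3 * (e div 2)\<close>; equality at \<open>e = 3\<close> explains the cube. It is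
  used to show that a sufficiently large prime power has exponent 1.\<close>

lemma prime_power_less_cube:
  fixes p e n S :: nat
  assumes "p ^ e dvd n" "e \<ge> 2" "p \<ge> 1" and nosq: "\<And>s. S \<le> s \<Longrightarrow> \<not> s\<^sup>2 dvd n"
  shows "p ^ e < S ^ 3"
proof -
  let ?s = "p ^ (e div 2)"
  have "?s\<^sup>2 dvd p ^ e" by (simp add: le_imp_power_dvd flip: power_mult)
  then have "?s < S" using assms(1) nosq[of ?s] dvd_trans by (metis not_le)
  have "p ^ e \<le> p ^ (e div 2 * 3)" using assms by (intro power_increasing) auto
  also have "\<dots> = ?s ^ 3" by (simp add: power_mult)
  also have "\<dots> < S ^ 3" using \<open>?s < S\<close> by (intro power_strict_mono) auto
  finally show ?thesis .
qed

text \<open>The bound on \<open>n\<close> is used up in two \<open>W\<close>-th roots: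
  \<open>n\<close> yields \<open>p\<close> above \<open>S ^ (6 * W)\<close>, and
  \<open>p + 1\<close> yields \<open>d\<close> above \<open>S ^ 6\<close>. The 6 is what the last
  step requires, where \<open>d\<close> is at most the divisor sum of \<open>q ^ u\<close>, hence at
  most the square of \<open>q ^ u\<close>, and \<open>q ^ u\<close> must exceed \<open>S ^ 3\<close>
  to exclude \<open>u \<ge> 2\<close>.\<close>

lemma common_divisor_of_shifted_primes:
  fixes n n' k S W :: nat
  assumes eq: "divisor_sum n' = k * divisor_sum n" and n': "n' \<ge> 1" and S: "S \<ge> 1" and W: "W \<ge> 1"
    and omega: "card (prime_factors n) \<le> W" "card (prime_factors n') \<le> W"
    and large: "S ^ (6 * W\<^sup>2) < n"
    and nosq: "\<And>s. S \<le> s \<Longrightarrow> \<not> s\<^sup>2 dvd n" "\<And>s. S \<le> s \<Longrightarrow> \<not> s\<^sup>2 dvd n'"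
  shows "\<exists>p q d. prime p \<and> prime q \<and> S ^ 6 < d \<and> d dvd p + 1 \<and> d dvd q + 1
    \<and> p dvd n \<and> \<not> p\<^sup>2 dvd n \<and> q dvd n' \<and> \<not> q\<^sup>2 dvd n'"
proof -
  have S_le: "S ^ i \<le> S ^ j" if "i \<le> j" for i j using S that by (intro power_increasing) auto
  have "1 \<le> S ^ (6 * W\<^sup>2)" using S by simp
  then have n: "n > 1" using large by linarith
  have "n dvd (\<Prod>p\<in>prime_factors n. p ^ multiplicity p n)"
    using prime_factorization_nat[of n] n by simp
  from exists_large_gcd[OF _ this n] obtain p where p: "p \<in> prime_factors n"
    and p_le: "n \<le> gcd n (p ^ multiplicity p n) ^ card (prime_factors n)" by auto
  define v where "v = multiplicity p n"
  have pv: "p ^ v dvd n" unfolding v_def by (rule multiplicity_dvd)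
  have pp: "prime p" using p by auto
  have "n \<le> (p ^ v) ^ card (prime_factors n)" using p_le pv by (simp add: v_def gcd_nat.absorb2)
  also have "\<dots> \<le> (p ^ v) ^ W" using omega pp by (intro power_increasing) (auto simp: prime_gt_0_nat Suc_le_eq)
  finally have "S ^ (6 * W\<^sup>2) < (p ^ v) ^ W" using large by simp
  then have "(S ^ (6 * W)) ^ W < (p ^ v) ^ W" by (simp add: power2_eq_square mult.assoc flip: power_mult)
  then have pv_gt: "S ^ (6 * W) < p ^ v" by (rule power_less_imp_less_base) simp
  have "v = 1"
  proof (rule ccontr)
    assume "v \<noteq> 1"
    moreover have "v > 0" using p by (simp add: v_def prime_factors_multiplicity)
    ultimately have "v \<ge> 2" by simp
    then have "p ^ v < S ^ 3" using prime_power_less_cube[OF pv] pp nosq(1) prime_gt_0_nat[OF pp] by simp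
    moreover have "S ^ 3 \<le> S ^ (6 * W)" using W by (intro S_le) simp
    ultimately show False using pv_gt by linarith
  qed
  then have p_gt: "S ^ (6 * W) < p" using pv_gt by simp
  have p2: "\<not> p\<^sup>2 dvd n"
    using \<open>v = 1\<close> n power_dvd_iff_le_multiplicity[where x = n and p = p and n = 2] prime_gt_1_nat[OF pp]
    unfolding v_def by auto
  obtain a where a: "n = p * a" using p by auto
  have "coprime p a" using pp p2 a by (intro prime_imp_coprime) (auto simp: power2_eq_square)
  then have "divisor_sum n = (p + 1) * divisor_sum a" unfolding a by (simp add: divisor_sum_mult_coprime divisor_sum_prime[OF pp])
  then have "p + 1 dvd divisor_sum n'" unfolding eq by (metis dvd_mult dvd_triv_left)
  also have "divisor_sum n' = (\<Prod>q\<in>prime_factors n'. divisor_sum (q ^ multiplicity q n'))"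
    using n' by (intro divisor_sum_prime_factors) simp
  finally have "p + 1 dvd (\<Prod>q\<in>prime_factors n'. divisor_sum (q ^ multiplicity q n'))" .
  from exists_large_gcd[OF _ this] obtain q where q: "q \<in> prime_factors n'"
    and q_le: "p + 1 \<le> gcd (p + 1) (divisor_sum (q ^ multiplicity q n')) ^ card (prime_factors n')"
    using prime_gt_0_nat[OF pp] by auto
  define u where "u = multiplicity q n'"
  define d where "d = gcd (p + 1) (divisor_sum (q ^ u))"
  have qp: "prime q" using q by auto
  have qu: "q ^ u dvd n'" unfolding u_def by (rule multiplicity_dvd)
  have "d > 0" by (simp add: d_def)
  then have "d ^ card (prime_factors n') \<le> d ^ W" using omega by (intro power_increasing) auto
  then have "(S ^ 6) ^ W < d ^ W" using q_le p_gt by (simp add: d_def u_def flip: power_mult)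
  then have d_gt: "S ^ 6 < d" by (rule power_less_imp_less_base) simp
  have qu0: "q ^ u > 0" using qp by (simp add: prime_gt_0_nat)
  \<comment> \<open>The crude quadratic bound for the divisor sum halves the exponent from 6 to
    3.\<close>
  have "d \<le> divisor_sum (q ^ u)" unfolding d_def using divisor_sum_pos[OF qu0] by (intro gcd_le2_nat) simp
  also have "\<dots> \<le> (q ^ u)\<^sup>2" using qu0 by (rule divisor_sum_le_square)
  finally have "(S ^ 3)\<^sup>2 < (q ^ u)\<^sup>2" using d_gt by (simp flip: power_mult)
  then have qu_gt: "S ^ 3 < q ^ u" by (rule power_less_imp_less_base) simp
  have "u = 1"
  proof (rule ccontr)
    assume "u \<noteq> 1"
    moreover have "u > 0" using q by (simp add: u_def prime_factors_multiplicity)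
    ultimately have "u \<ge> 2" by simp
    then have "q ^ u < S ^ 3" using prime_power_less_cube[OF qu] nosq(2) prime_gt_0_nat[OF qp] by simp
    then show False using qu_gt by simp
  qed
  have q2: "\<not> q\<^sup>2 dvd n'"
    using \<open>u = 1\<close> n' power_dvd_iff_le_multiplicity[where x = n' and p = q and n = 2] prime_gt_1_nat[OF qp]
    unfolding u_def by auto
  have "d dvd p + 1" "d dvd q + 1"
    using \<open>u = 1\<close> divisor_sum_prime[OF qp] unfolding d_def by auto
  moreover have "p dvd n" "q dvd n'" using p q by auto
  ultimately show ?thesis using pp qp d_gt p2 q2 by blast
qed

subsection \<open>Counting exceptional integers\<close>

lemma card_pairs_le:
  "real (card {(a, b). 1 \<le> a \<and> 1 \<le> b \<and> a * b \<le> (Y::nat)}) \<le> real Y * (1 + ln (real Y))"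
proof (cases "Y = 0")
  case True
  have "{(a, b). 1 \<le> a \<and> 1 \<le> b \<and> a * b \<le> Y} = {}" using True by auto
  then show ?thesis by (simp only: True card.empty)
next
  case False
  have "{(a, b). 1 \<le> a \<and> 1 \<le> b \<and> a * b \<le> Y} = (SIGMA a:{1..Y}. {1..Y div a})"
  proof (intro equalityI subsetI; clarsimp)
    fix a b assume *: "Suc 0 \<le> a" "Suc 0 \<le> b" "a * b \<le> Y"
    have "a * 1 \<le> a * b" using * by (intro mult_left_mono) auto
    then have "a \<le> Y" using *(3) by linarith
    moreover have "b \<le> Y div a" using * by (simp add: less_eq_div_iff_mult_less_eq mult.commute)
    ultimately show "a \<le> Y \<and> b \<le> Y div a" by simp
  next
    fix a b assume *: "Suc 0 \<le> a" "b \<le> Y div a"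
    then show "a * b \<le> Y" by (simp add: less_eq_div_iff_mult_less_eq mult.commute)
  qed
  then have "real (card {(a, b). 1 \<le> a \<and> 1 \<le> b \<and> a * b \<le> Y}) = (\<Sum>a=1..Y. real (Y div a))"
    by (simp add: card_SigmaI)
  also have "\<dots> \<le> (\<Sum>a=1..Y. real Y * (1 / real a))"
    using of_nat_div_le_of_nat[of Y] by (intro sum_mono) simp
  also have "\<dots> = real Y * (\<Sum>a=1..Y. 1 / real a)" by (simp only: sum_distrib_left)
  also have "\<dots> \<le> real Y * (1 + ln (real Y))"
    using sum_inverse_le_ln[of Y] False by (intro mult_left_mono) auto
  finally show ?thesis .
qed

text \<open>Distinct sets of prime factors have distinct products, all dividing
  \<open>n\<close>.\<close>

lemma two_power_card_prime_factors_le: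
  fixes n :: nat
  assumes "n > 0"
  shows "2 ^ card (prime_factors n) \<le> card {d. d dvd n}"
proof -
  have "2 ^ card (prime_factors n) = card (Pow (prime_factors n))" by (simp add: card_Pow)
  also have "\<dots> \<le> card {d. d dvd n}"
  proof (rule card_inj_on_le[of "\<lambda>D. \<Prod>D"])
    have *: "finite D" "\<And>p. p \<in> D \<Longrightarrow> prime p" if "D \<in> Pow (prime_factors n)" for D
    proof -
      have "D \<subseteq> prime_factors n" using that by simp
      then show "finite D" by (rule finite_subset) simp
      show "prime p" if "p \<in> D" for p using \<open>D \<subseteq> _\<close> that by auto
    qed
    show "inj_on (\<lambda>D. \<Prod>D) (Pow (prime_factors n))"
    proof (rule inj_onI)
      fix D E assume "D \<in> Pow (prime_factors n)" "E \<in> Pow (prime_factors n)" "\<Prod>D = \<Prod>E"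
      then show "D = E" using Prod_primes_eq_iff[of D E] * by blast
    qed
    show "(\<lambda>D. \<Prod>D) ` Pow (prime_factors n) \<subseteq> {d. d dvd n}"
    proof (rule image_subsetI)
      fix D assume D: "D \<in> Pow (prime_factors n)"
      then have "\<forall>p\<in>D. p dvd n" by auto
      then show "\<Prod>D \<in> {d. d dvd n}" using Prod_primes_dvd_iff[of D n] *[OF D] by blast
    qed
    show "finite {d. d dvd n}" using assms by simp
  qed
  finally show ?thesis .
qed

text \<open>Markov's inequality for the divisor function: each counted \<open>n\<close> has at least
  \<open>2 ^ W\<close> divisors, while the divisors of all \<open>n \<le> Y\<close> together are the
  pairs counted by \<open>card_pairs_le\<close>.\<close>

lemma card_many_prime_factors_le:
  "real (card {n \<in> {1..Y}. card (prime_factors n) > W}) \<le> real Y * (1 + ln (real Y)) / 2 ^ W"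
proof -
  let ?B = "{n \<in> {1..Y}. card (prime_factors n) > W}"
  have "2 ^ W * card ?B = (\<Sum>n\<in>?B. 2 ^ W)" by simp
  also have "\<dots> \<le> (\<Sum>n\<in>?B. card {d. d dvd n})"
  proof (intro sum_mono)
    fix n assume n: "n \<in> ?B"
    have "(2::nat) ^ W \<le> 2 ^ card (prime_factors n)" using n by (intro power_increasing) auto
    also have "\<dots> \<le> card {d. d dvd n}" using n by (intro two_power_card_prime_factors_le) auto
    finally show "2 ^ W \<le> card {d. d dvd n}" .
  qed
  also have "\<dots> \<le> (\<Sum>n=1..Y. card {d. d dvd n})" by (intro sum_mono2) auto
  also have "\<dots> = card (SIGMA n:{1..Y}. {d. d dvd n})" by (subst card_SigmaI) auto
  also have "\<dots> \<le> card {(a, b). 1 \<le> a \<and> 1 \<le> b \<and> a * b \<le> Y}"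
  proof (rule card_inj_on_le[of "\<lambda>(n, d). (d, n div d)"])
    show "inj_on (\<lambda>(n, d). (d, n div d)) (SIGMA n:{1..Y}. {d. d dvd n})"
    proof (rule inj_onI, clarify)
      fix m n d :: nat assume "d dvd m" "d dvd n" "m div d = n div d"
      then show "m = n \<and> d = d" by (metis dvd_div_mult_self)
    qed
    show "(\<lambda>(n, d). (d, n div d)) ` (SIGMA n:{1..Y}. {d. d dvd n}) \<subseteq> {(a, b). 1 \<le> a \<and> 1 \<le> b \<and> a * b \<le> Y}"
    proof (rule image_subsetI, clarify)
      fix n d assume n: "n \<in> {1..Y}" and d: "d dvd n"
      then obtain e where e: "n = d * e" by blast
      then have "d > 0" "e > 0" using n by (auto intro!: Nat.gr0I)
      then show "1 \<le> d \<and> 1 \<le> n div d \<and> d * (n div d) \<le> Y" using n e by simp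
    qed
    have "{(a, b). 1 \<le> a \<and> 1 \<le> b \<and> a * b \<le> Y} \<subseteq> {1..Y} \<times> {1..Y}"
    proof clarify
      fix a b assume *: "1 \<le> a" "1 \<le> b" "a * b \<le> Y"
      have "a * 1 \<le> a * b" "1 * b \<le> a * b" using * by (intro mult_mono; simp)+
      then have "a \<le> Y" "b \<le> Y" using *(3) by linarith+
      then show "a \<in> {1..Y} \<and> b \<in> {1..Y}" using * by simp
    qed
    then show "finite {(a, b). 1 \<le> a \<and> 1 \<le> b \<and> a * b \<le> Y}" by (rule finite_subset) simp
  qed
  finally have "real (2 ^ W * card ?B) \<le> real (card {(a, b). 1 \<le> a \<and> 1 \<le> b \<and> a * b \<le> Y})"
    by (simp only: of_nat_le_iff)
  also have "\<dots> \<le> real Y * (1 + ln (real Y))" by (rule card_pairs_le)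
  finally show ?thesis by (simp add: field_simps)
qed

lemma card_multiples_le: "real (card {n \<in> {1..Y}. m dvd n}) \<le> real Y / real m" if "m > 0" for m Y :: nat
proof -
  have "{n \<in> {1..Y}. m dvd n} \<subseteq> (\<lambda>i. m * i) ` {1..Y div m}"
  proof
    fix n assume n: "n \<in> {n \<in> {1..Y}. m dvd n}"
    then obtain i where i: "n = m * i" by auto
    then have "i \<in> {1..Y div m}"
      using n that by (auto simp: less_eq_div_iff_mult_less_eq mult.commute Suc_le_eq intro!: Nat.gr0I)
    then show "n \<in> (\<lambda>i. m * i) ` {1..Y div m}" using i by blast
  qed
  then have "card {n \<in> {1..Y}. m dvd n} \<le> card {1..Y div m}"
    by (rule surj_card_le[rotated]) simp
  then have "real (card {n \<in> {1..Y}. m dvd n}) \<le> real (Y div m)" by simp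
  also have "\<dots> \<le> real Y / real m" by (rule of_nat_div_le_of_nat)
  finally show ?thesis .
qed

lemma card_large_square_divisor_le:
  assumes "S \<ge> 1"
  shows "real (card {n \<in> {1..Y}. \<exists>s\<ge>S. s\<^sup>2 dvd n}) \<le> 2 * real Y / real S"
proof -
  have "{n \<in> {1..Y}. \<exists>s\<ge>S. s\<^sup>2 dvd n} \<subseteq> (\<Union>s\<in>{S..Y}. {n \<in> {1..Y}. s\<^sup>2 dvd n})"
  proof
    fix n assume "n \<in> {n \<in> {1..Y}. \<exists>s\<ge>S. s\<^sup>2 dvd n}"
    then obtain s where s: "n \<in> {1..Y}" "s \<ge> S" "s\<^sup>2 dvd n" by blast
    then have "s \<le> s\<^sup>2" "s\<^sup>2 \<le> n" by (auto simp: power2_eq_square intro: dvd_imp_le)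
    then show "n \<in> (\<Union>s\<in>{S..Y}. {n \<in> {1..Y}. s\<^sup>2 dvd n})" using s by auto
  qed
  then have "card {n \<in> {1..Y}. \<exists>s\<ge>S. s\<^sup>2 dvd n} \<le> card (\<Union>s\<in>{S..Y}. {n \<in> {1..Y}. s\<^sup>2 dvd n})"
    by (intro card_mono) auto
  also have "\<dots> \<le> (\<Sum>s\<in>{S..Y}. card {n \<in> {1..Y}. s\<^sup>2 dvd n})" by (rule card_UN_le) simp
  finally have "real (card {n \<in> {1..Y}. \<exists>s\<ge>S. s\<^sup>2 dvd n})
      \<le> (\<Sum>s\<in>{S..Y}. real (card {n \<in> {1..Y}. s\<^sup>2 dvd n}))"
    by (simp only: of_nat_le_iff flip: of_nat_sum)
  also have "\<dots> \<le> (\<Sum>s\<in>{S..Y}. real Y * (1 / (real s)\<^sup>2))"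
  proof (intro sum_mono)
    fix s assume "s \<in> {S..Y}"
    then have "s\<^sup>2 > 0" using assms by simp
    from card_multiples_le[OF this, of Y]
    show "real (card {n \<in> {1..Y}. s\<^sup>2 dvd n}) \<le> real Y * (1 / (real s)\<^sup>2)" by simp
  qed
  also have "\<dots> = real Y * (\<Sum>s\<in>{S..Y}. 1 / (real s)\<^sup>2)" by (simp only: sum_distrib_left)
  also have "\<dots> \<le> real Y * (2 / real S)"
    using sum_inverse_squares_le[OF assms] by (intro mult_left_mono) auto
  finally show ?thesis by (simp add: mult_ac)
qed

text \<open>Write \<open>p = d * m - 1\<close> and \<open>q = d * l - 1\<close>. For fixed
  \<open>(d, m, l)\<close> the \<open>n\<close> lie in one class modulo \<open>p * q\<close>, so
  there are at most \<open>X / (p * q) + 1\<close> of them, and the 1 is at most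
  \<open>V / (p * q)\<close>. Replacing \<open>p\<close> and \<open>q\<close> by
  \<open>d * m / 2\<close> and \<open>d * l / 2\<close>, the sum over \<open>d > z\<close> of
  \<open>1 / d^2\<close> saves \<open>z\<close>, and the sums over \<open>m\<close> and
  \<open>l\<close> cost one logarithm each.\<close>

lemma card_common_shifted_divisor_le:
  fixes X h z V :: nat
  assumes z: "h < z" and h: "h \<ge> 1"
  shows "real (card {n \<in> {1..X}. \<exists>p q d. prime p \<and> prime q \<and> z < d \<and> d dvd p + 1 \<and> d dvd q + 1
      \<and> p dvd n \<and> q dvd n + h \<and> p * q \<le> V})
    \<le> 8 * (real X + real V) * (1 + ln (real (X + h + 1)))\<^sup>2 / real z"
proof -
  define Y where "Y = X + h + 1"
  define R where "R = (\<lambda>(d, m, l). {n \<in> {1..X}. prime (d * m - 1) \<and> prime (d * l - 1)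
    \<and> (d * m - 1) dvd n \<and> (d * l - 1) dvd n + h \<and> (d * m - 1) * (d * l - 1) \<le> V})"
  define I where "I = {z+1..Y} \<times> {1..Y} \<times> {1..Y}"
  have finI: "finite I" by (simp add: I_def)
  have finR: "finite (R i)" for i by (auto simp: R_def split: prod.splits)
  have "{n \<in> {1..X}. \<exists>p q d. prime p \<and> prime q \<and> z < d \<and> d dvd p + 1 \<and> d dvd q + 1
      \<and> p dvd n \<and> q dvd n + h \<and> p * q \<le> V} \<subseteq> (\<Union>i\<in>I. R i)"
  proof
    fix n assume "n \<in> {n \<in> {1..X}. \<exists>p q d. prime p \<and> prime q \<and> z < d \<and> d dvd p + 1 \<and> d dvd q + 1
      \<and> p dvd n \<and> q dvd n + h \<and> p * q \<le> V}"
    then obtain p q d where n: "n \<in> {1..X}" and pq: "prime p" "prime q" "z < d" "d dvd p + 1" "d dvd q + 1"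
      "p dvd n" "q dvd n + h" "p * q \<le> V" by blast
    obtain m where m: "p + 1 = d * m" using pq(4) by blast
    obtain l where l: "q + 1 = d * l" using pq(5) by blast
    have pm: "d * m - 1 = p" "d * l - 1 = q" using m l by linarith+
    have ml: "m \<ge> 1" "l \<ge> 1" using m l by (auto simp: Suc_le_eq intro!: Nat.gr0I)
    have "p \<le> n" "q \<le> n + h" using pq n by (auto intro!: dvd_imp_le)
    then have dm: "d * m \<le> Y" "d * l \<le> Y" using m l n unfolding Y_def by simp_all
    have "d * 1 \<le> d * m" "1 * m \<le> d * m" "1 * l \<le> d * l" using ml pq(3) by (intro mult_mono; simp)+
    then have "d \<le> Y" "m \<le> Y" "l \<le> Y" using dm by linarith+
    then have "(d, m, l) \<in> I" using ml pq(3) by (simp add: I_def)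
    moreover have "n \<in> R (d, m, l)" using n pq unfolding R_def by (simp only: prod.case pm) blast
    ultimately show "n \<in> (\<Union>i\<in>I. R i)" by blast
  qed
  then have "card {n \<in> {1..X}. \<exists>p q d. prime p \<and> prime q \<and> z < d \<and> d dvd p + 1 \<and> d dvd q + 1
      \<and> p dvd n \<and> q dvd n + h \<and> p * q \<le> V} \<le> card (\<Union>i\<in>I. R i)"
    using finI finR by (intro card_mono) auto
  also have "\<dots> \<le> (\<Sum>i\<in>I. card (R i))" using finI by (rule card_UN_le)
  finally have 1: "real (card {n \<in> {1..X}. \<exists>p q d. prime p \<and> prime q \<and> z < d \<and> d dvd p + 1 \<and> d dvd q + 1
      \<and> p dvd n \<and> q dvd n + h \<and> p * q \<le> V}) \<le> (\<Sum>i\<in>I. real (card (R i)))"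
    by (simp only: of_nat_le_iff flip: of_nat_sum)
  have 2: "real (card (R (d, m, l))) \<le> 4 * (real X + real V) * (1 / (real d)\<^sup>2 * (1 / real m * (1 / real l)))"
    if "(d, m, l) \<in> I" for d m l
  \<comment> \<open>Membership in \<open>I\<close> bounds the parameters only; a member of
    \<open>R (d, m, l)\<close> supplies primality and \<open>p * q \<le> V\<close>.\<close>
  proof (cases "R (d, m, l) = {}")
    case True
    then show ?thesis by simp
  next
    case False
    define p where "p = d * m - 1"
    define q where "q = d * l - 1"
    from False obtain n0 where "n0 \<in> R (d, m, l)" by blast
    then have pq: "prime p" "prime q" "p * q \<le> V" and n0: "p dvd n0" "q dvd n0 + h"
      by (simp_all add: R_def p_def q_def)
    have dml: "d > z" "m \<ge> 1" "l \<ge> 1" using that by (auto simp: I_def)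
    have "d * 1 \<le> d * m" "d * 1 \<le> d * l" using dml by (intro mult_left_mono; simp)+
    then have big: "p \<ge> z" "q \<ge> z" "d * m = p + 1" "d * l = q + 1"
      using dml(1) unfolding p_def q_def by linarith+
    \<comment> \<open>A common prime would divide both \<open>n0\<close> and \<open>n0 + h\<close>,
      hence \<open>h\<close>, although it is at least \<open>z > h\<close>.\<close>
    have "p \<noteq> q"
    proof
      assume "p = q"
      then have "p dvd h" using n0 by (simp add: dvd_add_right_iff)
      then have "p \<le> h" using h by (intro dvd_imp_le) auto
      then show False using big z by simp
    qed
    then have cop: "coprime p q" using pq by (simp add: primes_coprime)
    have "card (R (d, m, l)) \<le> X div (p * q) + 1"
    proof (rule card_congruent_le)
      show "R (d, m, l) \<subseteq> {1..X}" by (auto simp: R_def)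
      show "p * q > 0" using pq by (simp add: prime_gt_0_nat)
      fix s t assume "s \<in> R (d, m, l)" "t \<in> R (d, m, l)"
      then have st: "p dvd s" "q dvd s + h" "p dvd t" "q dvd t + h" by (simp_all add: R_def p_def q_def)
      have "[s = t] (mod p)" using st by (metis cong_0_iff cong_sym cong_trans)
      moreover have "[s + h = t + h] (mod q)" using st by (metis cong_0_iff cong_sym cong_trans)
      then have "[s = t] (mod q)" by (simp add: cong_add_rcancel_nat)
      ultimately show "[s = t] (mod p * q)" using cop by (rule coprime_cong_mult_nat)
    qed
    then have "real (card (R (d, m, l))) \<le> real (X div (p * q)) + 1" by (simp flip: of_nat_Suc)
    also have "\<dots> \<le> real X / real (p * q) + real V / real (p * q)"
    proof (intro add_mono of_nat_div_le_of_nat)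
      have "real (p * q) \<le> real V" "real (p * q) > 0" using pq by (simp_all add: prime_gt_0_nat flip: of_nat_mult)
      then show "1 \<le> real V / real (p * q)" by (simp add: field_simps)
    qed
    also have "\<dots> = (real X + real V) * (1 / real p * (1 / real q))" by (simp add: add_divide_distrib)
    also have "\<dots> \<le> (real X + real V) * (2 / (real d * real m) * (2 / (real d * real l)))"
    proof (intro mult_left_mono mult_mono)
      have dm: "real d * real m = real p + 1" "real d * real l = real q + 1"
        using big(3,4) by (metis of_nat_1 of_nat_add of_nat_mult)+
      have "real p \<ge> 1" "real q \<ge> 1" using prime_ge_1_nat[OF pq(1)] prime_ge_1_nat[OF pq(2)] by simp_all
      then show "1 / real p \<le> 2 / (real d * real m)" "1 / real q \<le> 2 / (real d * real l)"
        unfolding dm by (simp_all add: field_simps)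
    qed auto
    also have "\<dots> = 4 * (real X + real V) * (1 / (real d)\<^sup>2 * (1 / real m * (1 / real l)))"
    proof -
      have "c * (2 / (real d * real m) * (2 / (real d * real l)))
          = 4 * c * (1 / (real d)\<^sup>2 * (1 / real m * (1 / real l)))" for c
        by (simp add: power2_eq_square mult_ac)
      then show ?thesis .
    qed
    finally show ?thesis .
  qed
  have Y1: "Y \<ge> 1" by (simp add: Y_def)
  then have harm: "(\<Sum>m=1..Y. 1 / real m) \<le> 1 + ln (real Y)" by (rule sum_inverse_le_ln)
  have "(\<Sum>i\<in>I. real (card (R i)))
      \<le> (\<Sum>(d, m, l)\<in>I. 4 * (real X + real V) * (1 / (real d)\<^sup>2 * (1 / real m * (1 / real l))))"
    using 2 by (intro sum_mono) auto
  also have "\<dots> = 4 * (real X + real V) * (\<Sum>(d, m, l)\<in>I. 1 / (real d)\<^sup>2 * (1 / real m * (1 / real l)))"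
    unfolding sum_distrib_left by (intro sum.cong) auto
  also have "(\<Sum>(d, m, l)\<in>I. 1 / (real d)\<^sup>2 * (1 / real m * (1 / real l)))
      = (\<Sum>d=z+1..Y. 1 / (real d)\<^sup>2) * ((\<Sum>m=1..Y. 1 / real m) * (\<Sum>l=1..Y. 1 / real l))"
    unfolding I_def sum_product sum.cartesian_product by (intro sum.cong) auto
  also have "4 * (real X + real V) * ((\<Sum>d=z+1..Y. 1 / (real d)\<^sup>2) * ((\<Sum>m=1..Y. 1 / real m) * (\<Sum>l=1..Y. 1 / real l)))
    \<le> 4 * (real X + real V) * (2 / real z * ((1 + ln (real Y)) * (1 + ln (real Y))))"
  proof (intro mult_left_mono mult_mono)
    have "(\<Sum>d=z+1..Y. 1 / (real d)\<^sup>2) \<le> 2 / real (z + 1)" by (rule sum_inverse_squares_le) simp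
    also have "\<dots> \<le> 2 / real z" using z by (intro divide_left_mono) auto
    finally show "(\<Sum>d=z+1..Y. 1 / (real d)\<^sup>2) \<le> 2 / real z" .
  qed (use harm Y1 in \<open>auto intro!: sum_nonneg mult_nonneg_nonneg\<close>)
  also have "\<dots> = 8 * (real X + real V) * (1 + ln (real Y))\<^sup>2 / real z"
  proof -
    have "4 * c * (2 / real z * (e * e)) = 8 * c * e\<^sup>2 / real z" for c e
      by (simp add: power2_eq_square)
    then show ?thesis .
  qed
  finally show ?thesis using 1 unfolding Y_def by linarith
qed

text \<open>For fixed \<open>(a, b)\<close> the primes solve \<open>b * q - a * p = h\<close>
  together with \<open>B * (q + 1) = A * (p + 1)\<close>, where \<open>A\<close> is \<open>k\<close>
  times the divisor sum of \<open>a\<close> and \<open>B\<close> is that of \<open>b\<close>. Two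
  different solutions force the determinant \<open>B * a - A * b\<close> to vanish. The second
  equation then becomes \<open>b * (q + 1) = a * (p + 1)\<close>, and comparison with the first
  gives \<open>a = b + h\<close>.\<close>

lemma prime_pair_unique:
  fixes a b p q p' q' h k :: nat
  assumes primes: "prime p" "prime q" "prime p'" "prime q'"
    and ndvd: "\<not> p dvd a" "\<not> q dvd b" "\<not> p' dvd a" "\<not> q' dvd b"
    and lin: "a * p + h = b * q" "a * p' + h = b * q'"
    and eq: "divisor_sum (b * q) = k * divisor_sum (a * p)" "divisor_sum (b * q') = k * divisor_sum (a * p')"
    and ne: "a \<noteq> b + h"
  shows "p = p'"
proof (rule ccontr)
  assume "p \<noteq> p'"
  define A where "A = int (k * divisor_sum a)"
  define B where "B = int (divisor_sum b)"
  have "b > 0" using ndvd(2) by (auto intro!: Nat.gr0I)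
  then have B: "B > 0" using divisor_sum_pos by (simp add: B_def)
  have mult: "divisor_sum (c * r) = divisor_sum c * (r + 1)" if "prime r" "\<not> r dvd c" for c r
  proof -
    have "coprime c r" using prime_imp_coprime[OF that] by (simp add: coprime_commute)
    then show ?thesis by (simp add: divisor_sum_mult_coprime divisor_sum_prime[OF that(1)])
  qed
  have "divisor_sum b * (q + 1) = k * divisor_sum a * (p + 1)"
    using eq(1) unfolding mult[OF primes(1) ndvd(1)] mult[OF primes(2) ndvd(2)] by (simp only: mult.assoc)
  then have 1: "B * (int q + 1) = A * (int p + 1)"
    unfolding A_def B_def by (metis of_nat_1 of_nat_add of_nat_mult)
  have "divisor_sum b * (q' + 1) = k * divisor_sum a * (p' + 1)"
    using eq(2) unfolding mult[OF primes(3) ndvd(3)] mult[OF primes(4) ndvd(4)] by (simp only: mult.assoc)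
  then have 2: "B * (int q' + 1) = A * (int p' + 1)"
    unfolding A_def B_def by (metis of_nat_1 of_nat_add of_nat_mult)
  have 3: "int a * int p + int h = int b * int q" using lin(1) by (metis of_nat_add of_nat_mult)
  have 4: "int a * int p' + int h = int b * int q'" using lin(2) by (metis of_nat_add of_nat_mult)
  have "(B * int a - A * int b) * (int p - int p') = 0" using 1 2 3 4 by algebra
  then have 5: "B * int a = A * int b" using \<open>p \<noteq> p'\<close> by simp
  have "B * (int b + int h - int a) = 0" using 1 3 5 by algebra
  then have "int b + int h = int a" using B by simp
  then show False using ne by linarith
qed

text \<open>By \<open>prime_pair_unique\<close> the pair \<open>(a, b)\<close> determines
  \<open>n\<close>, and \<open>a * b * p * q = n * (n + h)\<close> with \<open>p * q > X * U\<close>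
  leaves \<open>a * b\<close> below \<open>(X + h) / U\<close>.\<close>

lemma card_nondegenerate_le:
  fixes X U h k :: nat
  assumes U: "U \<ge> 1" and X: "X \<ge> 1"
  shows "real (card {n \<in> {1..X}. divisor_sum (n + h) = k * divisor_sum n \<and>
      (\<exists>p q a b. prime p \<and> prime q \<and> n = a * p \<and> n + h = b * q \<and> \<not> p dvd a \<and> \<not> q dvd b
        \<and> a \<noteq> b + h \<and> X * U < p * q)})
    \<le> real ((X + h) div U) * (1 + ln (real ((X + h) div U)))"
proof -
  define N where "N = {n \<in> {1..X}. divisor_sum (n + h) = k * divisor_sum n \<and>
      (\<exists>p q a b. prime p \<and> prime q \<and> n = a * p \<and> n + h = b * q \<and> \<not> p dvd a \<and> \<not> q dvd b
        \<and> a \<noteq> b + h \<and> X * U < p * q)}"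
  define Q where "Q = (\<lambda>n (a, b). \<exists>p q. prime p \<and> prime q \<and> n = a * p \<and> n + h = b * q \<and> \<not> p dvd a \<and> \<not> q dvd b
        \<and> a \<noteq> b + h \<and> X * U < p * q)"
  have "\<forall>n\<in>N. \<exists>ab. Q n ab"
  proof
    fix n assume "n \<in> N"
    then have "\<exists>p q a b. prime p \<and> prime q \<and> n = a * p \<and> n + h = b * q \<and> \<not> p dvd a \<and> \<not> q dvd b
        \<and> a \<noteq> b + h \<and> X * U < p * q" unfolding N_def mem_Collect_eq by (elim conjE)
    then obtain p q a b where "prime p \<and> prime q \<and> n = a * p \<and> n + h = b * q \<and> \<not> p dvd a \<and> \<not> q dvd b
        \<and> a \<noteq> b + h \<and> X * U < p * q" by (elim exE)
    then have "Q n (a, b)" unfolding Q_def prod.case by (intro exI)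
    then show "\<exists>ab. Q n ab" by (rule exI)
  qed
  \<comment> \<open>One \<open>n\<close> may admit several factorisations; \<open>f\<close> fixes
    one of them for each \<open>n\<close>.\<close>
  from bchoice[OF this] obtain f where f: "\<And>n. n \<in> N \<Longrightarrow> Q n (f n)" by blast
  have "card N \<le> card {(a, b). 1 \<le> a \<and> 1 \<le> b \<and> a * b \<le> (X + h) div U}"
  proof (rule card_inj_on_le[of f])
    show "inj_on f N"
    proof (rule inj_onI)
      fix m n assume mn: "m \<in> N" "n \<in> N" "f m = f n"
      obtain a b where ab: "f m = (a, b)" by (cases "f m")
      have "Q m (a, b)" "Q n (a, b)" using f[OF mn(1)] f[OF mn(2)] mn(3) ab by simp_all
      note Qmn = this[unfolded Q_def prod.case]
      from Qmn(1) obtain p q where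
        pq: "prime p" "prime q" "m = a * p" "m + h = b * q" "\<not> p dvd a" "\<not> q dvd b" "a \<noteq> b + h"
        by (elim exE conjE)
      from Qmn(2) obtain p' q' where
        pq': "prime p'" "prime q'" "n = a * p'" "n + h = b * q'" "\<not> p' dvd a" "\<not> q' dvd b"
        by (elim exE conjE)
      have "divisor_sum (m + h) = k * divisor_sum m" "divisor_sum (n + h) = k * divisor_sum n"
        using mn by (simp_all add: N_def)
      then have "divisor_sum (b * q) = k * divisor_sum (a * p)" "divisor_sum (b * q') = k * divisor_sum (a * p')"
        using pq pq' by simp_all
      then have "p = p'"
        using pq pq' by (intro prime_pair_unique[of p q p' q' a b h k]) simp_all
      then show "m = n" using pq pq' by simp
    qed
    show "f ` N \<subseteq> {(a, b). 1 \<le> a \<and> 1 \<le> b \<and> a * b \<le> (X + h) div U}"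
    proof (rule image_subsetI)
      fix n assume n: "n \<in> N"
      obtain a b where ab: "f n = (a, b)" by (cases "f n")
      have "Q n (a, b)" using f[OF n] ab by simp
      then obtain p q where pq: "n = a * p" "n + h = b * q" "\<not> p dvd a" "\<not> q dvd b" "X * U < p * q"
        unfolding Q_def prod.case by (elim exE conjE)
      have pos: "a > 0" "b > 0" using pq(3,4) by (auto intro!: Nat.gr0I)
      have "(a * b * U) * X = (a * b) * (X * U)" by simp
      also have "\<dots> < (a * b) * (p * q)" using pos pq(5) by (intro mult_strict_left_mono) simp_all
      also have "\<dots> = n * (n + h)" unfolding pq(2) unfolding pq(1) by (simp only: mult_ac)
      also have "\<dots> \<le> X * (X + h)" using n by (intro mult_mono) (auto simp: N_def)
      finally have "(a * b * U) * X < (X + h) * X" by (simp only: mult.commute)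
      then have "a * b * U < X + h" by (simp only: mult_less_cancel2)
      then have "a * b * U \<le> X + h" by simp
      then have "a * b \<le> (X + h) div U" using U by (simp add: less_eq_div_iff_mult_less_eq)
      then show "f n \<in> {(a, b). 1 \<le> a \<and> 1 \<le> b \<and> a * b \<le> (X + h) div U}"
        using pos by (simp add: ab Suc_le_eq)
    qed
    have "{(a, b). 1 \<le> a \<and> 1 \<le> b \<and> a * b \<le> (X + h) div U} \<subseteq> {1..(X + h) div U} \<times> {1..(X + h) div U}"
    proof clarify
      fix a b assume *: "1 \<le> a" "1 \<le> b" "a * b \<le> (X + h) div U"
      have "a * 1 \<le> a * b" "1 * b \<le> a * b" using * by (intro mult_mono; simp)+
      then have "a \<le> (X + h) div U" "b \<le> (X + h) div U" using *(3) by linarith+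
      then show "a \<in> {1..(X + h) div U} \<and> b \<in> {1..(X + h) div U}" using * by simp
    qed
    then show "finite {(a, b). 1 \<le> a \<and> 1 \<le> b \<and> a * b \<le> (X + h) div U}" by (rule finite_subset) simp
  qed
  then have "real (card N) \<le> real (card {(a, b). 1 \<le> a \<and> 1 \<le> b \<and> a * b \<le> (X + h) div U})" by simp
  also have "\<dots> \<le> real ((X + h) div U) * (1 + ln (real ((X + h) div U)))" by (rule card_pairs_le)
  finally show ?thesis unfolding N_def .
qed

text \<open>For \<open>a = b + h\<close> the relation \<open>b * q - a * p = h\<close> reads
  \<open>a * (p + 1) = b * (q + 1)\<close>. This leaves one free parameter \<open>t\<close>, and
  primality of \<open>p\<close> and \<open>q\<close> becomes the sieve problem treated
  above.\<close>

lemma card_degenerate_le: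
  fixes X b h :: nat
  assumes b: "b \<ge> 1" and h: "h \<ge> 1"
  shows "card {n \<in> {1..X}. \<exists>p q. prime p \<and> prime q \<and> n = (b + h) * p \<and> n + h = b * q}
    \<le> card {t \<in> {1..2 * X * h div b\<^sup>2}. prime ((b + h) div gcd b h * t - 1) \<and> prime (b div gcd b h * t - 1)}"
proof (rule surj_card_le)
  let ?f = "\<lambda>t. (b + h) * (b div gcd b h * t - 1)"
  show "{n \<in> {1..X}. \<exists>p q. prime p \<and> prime q \<and> n = (b + h) * p \<and> n + h = b * q}
    \<subseteq> ?f ` {t \<in> {1..2 * X * h div b\<^sup>2}. prime ((b + h) div gcd b h * t - 1) \<and> prime (b div gcd b h * t - 1)}"
  proof
    fix n assume "n \<in> {n \<in> {1..X}. \<exists>p q. prime p \<and> prime q \<and> n = (b + h) * p \<and> n + h = b * q}"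
    then obtain p q where n: "n \<in> {1..X}" and pq: "prime p" "prime q" "n = (b + h) * p" "n + h = b * q" by blast
    \<comment> \<open>$a'(p + 1) = b'(q + 1)$ with coprime $a' = b' + h'$ and $b'$, so $p = b't - 1$ and $q = a't - 1$\<close>
    define g where "g = gcd b h"
    define b' where "b' = b div g"
    define h' where "h' = h div g"
    have g: "g > 0" "g \<le> h" using h by (auto simp: g_def intro: gcd_le2_nat)
    have bg: "b = g * b'" "h = g * h'" unfolding b'_def h'_def g_def by simp_all
    have a': "(b + h) div g = b' + h'" using g(1) by (simp add: bg flip: distrib_left)
    have "coprime b' h'" unfolding b'_def h'_def g_def using b by (intro div_gcd_coprime) auto
    then have cop: "coprime (b' + h') b'"
      by (metis coprime_iff_gcd_eq_1 gcd.commute gcd_add1 add.commute)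
    have "g * ((b' + h') * p + h') = g * (b' * q)"
      using pq(3,4) unfolding bg by (simp add: algebra_simps)
    then have "(b' + h') * p + h' = b' * q" using g(1) by simp
    then have e: "(b' + h') * (p + 1) = b' * (q + 1)" by (simp add: algebra_simps)
    then have "b' + h' dvd b' * (q + 1)" by (metis dvd_triv_left)
    then have "b' + h' dvd q + 1" unfolding coprime_dvd_mult_right_iff[OF cop] .
    then obtain t where t: "q + 1 = (b' + h') * t" by blast
    have b'pos: "b' > 0" using b bg by (auto intro!: Nat.gr0I)
    have eq: "(b' + h') * (p + 1) = (b' + h') * (b' * t)" unfolding e t by (simp only: mult_ac)
    have "b' + h' \<noteq> 0" using b'pos by simp
    from iffD1[OF mult_left_cancel[OF this] eq] have pt: "p + 1 = b' * t" .
    have t1: "t \<ge> 1" using t by (auto simp: Suc_le_eq intro!: Nat.gr0I)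
    have pq': "b' * t - 1 = p" "(b' + h') * t - 1 = q" using pt t by linarith+
    \<comment> \<open>Passing from \<open>p\<close> to \<open>p + 1\<close> adds
      \<open>b + h\<close>, which is at most \<open>n\<close>; this gives the 2 in the range of
      \<open>t\<close>.\<close>
    have "b + h \<le> n" using pq(3) prime_ge_1_nat[OF pq(1)] by simp
    moreover have "(b + h) * (p + 1) = n + (b + h)" by (simp add: pq(3))
    moreover have "n \<le> X" using n by simp
    ultimately have "(b + h) * (p + 1) \<le> 2 * X" by linarith
    then have *: "(b + h) * (b' * t) \<le> 2 * X" by (simp only: pt)
    \<comment> \<open>Replacing \<open>b'\<close> by \<open>b\<close> costs the factor
      \<open>g\<close>, which is at most \<open>h\<close>.\<close>
    have "b\<^sup>2 * t = g * (b * (b' * t))" unfolding power2_eq_square using bg(1) by (metis mult.assoc mult.left_commute)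
    also have "\<dots> \<le> h * ((b + h) * (b' * t))" using g by (intro mult_mono) auto
    also have "\<dots> \<le> h * (2 * X)" using * by (intro mult_left_mono) auto
    finally have "t \<le> 2 * X * h div b\<^sup>2" using b by (simp add: less_eq_div_iff_mult_less_eq mult_ac)
    moreover have eqs: "(b + h) div gcd b h = b' + h'" "b div gcd b h = b'"
      using a' by (simp_all only: g_def b'_def)
    ultimately have "t \<in> {t \<in> {1..2 * X * h div b\<^sup>2}. prime ((b + h) div gcd b h * t - 1) \<and> prime (b div gcd b h * t - 1)}"
      using t1 pq(1,2) by (simp only: eqs pq' mem_Collect_eq atLeastAtMost_iff simp_thms)
    moreover have "n = ?f t" using pq(3) by (simp only: eqs pq')
    ultimately show "n \<in> ?f ` {t \<in> {1..2 * X * h div b\<^sup>2}. prime ((b + h) div gcd b h * t - 1) \<and> prime (b div gcd b h * t - 1)}"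
      by (rule image_eqI[rotated])
  qed
qed simp

subsection \<open>Asymptotics\<close>

lemma summable_log_square_over_square:
  assumes "c > 0"
  shows "summable (\<lambda>b::nat. (1 + ln (c * (real b)\<^sup>2))\<^sup>2 / (real b)\<^sup>2)"
proof (rule summable_comparison_test_bigo)
  \<comment> \<open>The gap between the exponents 2 and 3/2 absorbs the squared logarithm.\<close>
  show "summable (\<lambda>b::nat. norm (real b powr (-3/2)))"
    by (simp add: summable_real_powr_iff)
  show "(\<lambda>b::nat. (1 + ln (c * (real b)\<^sup>2))\<^sup>2 / (real b)\<^sup>2) \<in> O(\<lambda>b. real b powr (-3/2))"
    using assms by real_asymp
qed

text \<open>For \<open>b \<le> S\<close> the condition \<open>S ^ 4 \<le> X\<close> leaves a range
  of at least \<open>sqrt X\<close> values of \<open>t\<close>, so the sieve saves a full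
  \<open>(ln X)\<^sup>2\<close> up to a factor 4, and the sum over \<open>b\<close> converges. For
  \<open>b > S\<close> the trivial bound by the length of the range is enough and gives the tail of
  a series of inverse squares.\<close>

lemma card_degenerate_union_le:
  fixes h :: nat
  assumes h: "h \<ge> 1"
  shows "\<exists>C X0. \<forall>X S. X0 \<le> X \<longrightarrow> 1 \<le> S \<longrightarrow> S ^ 4 \<le> X \<longrightarrow>
    real (card (\<Union>b\<in>{1..X}. {n \<in> {1..X}. \<exists>p q. prime p \<and> prime q \<and> n = (b + h) * p \<and> n + h = b * q}))
      \<le> C * real X / (ln (real X))\<^sup>2 + 4 * real X * real h / real S"
proof -
  obtain C N0 where C: "C > 0" and sieve: "\<And>N a b. N0 \<le> N \<Longrightarrow> 0 < b \<Longrightarrow> b < a \<Longrightarrow>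
     real (card {t \<in> {1..N}. prime (a * t - 1) \<and> prime (b * t - 1)})
       \<le> C * (1 + ln (real (2 * (a * b * (a - b)))))\<^sup>2 * real N / (ln (real N))\<^sup>2"
    using card_prime_pairs_asymp by blast
  \<comment> \<open>From \<open>b + h \<le> 2 * b * h\<close> the sieve modulus is at most
    \<open>2 * (2 * b * h) * b * h = c * b^2\<close>.\<close>
  define c where "c = 4 * (real h)\<^sup>2"
  define K where "K = (\<lambda>b::nat. (1 + ln (c * (real b)\<^sup>2))\<^sup>2 / (real b)\<^sup>2)"
  have sumK: "summable K" unfolding K_def c_def using h by (intro summable_log_square_over_square) simp
  have K0: "K b \<ge> 0" for b by (simp add: K_def)
  \<comment> \<open>The square in \<open>N0\<^sup>2 + 2\<close> puts \<open>sqrt X\<close> beyond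
    the threshold of the sieve bound.\<close>
  have bound: "real (card (\<Union>b\<in>{1..X}. {n \<in> {1..X}. \<exists>p q. prime p \<and> prime q \<and> n = (b + h) * p \<and> n + h = b * q}))
      \<le> (8 * C * real h * suminf K) * real X / (ln (real X))\<^sup>2 + 4 * real X * real h / real S"
    if X: "X \<ge> N0\<^sup>2 + 2" and S: "S \<ge> 1" "S ^ 4 \<le> X" for X S
  proof -
    define D where "D = (\<lambda>b. {n \<in> {1..X}. \<exists>p q. prime p \<and> prime q \<and> n = (b + h) * p \<and> n + h = b * q})"
    define N where "N = (\<lambda>b::nat. 2 * X * h div b\<^sup>2)"
    define T where "T = (\<lambda>b. {t \<in> {1..N b}. prime ((b + h) div gcd b h * t - 1) \<and> prime (b div gcd b h * t - 1)})"
    have X2: "real X \<ge> 2" using X by simp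
    have lnX: "ln (real X) > 0" using X2 by simp
    have DT: "card (D b) \<le> card (T b)" if "b \<ge> 1" for b
      unfolding D_def T_def N_def using that h by (rule card_degenerate_le)
    have Nle: "real (N b) \<le> 2 * real X * real h / (real b)\<^sup>2" for b
      unfolding N_def using of_nat_div_le_of_nat[of "2 * X * h" "b\<^sup>2"] by simp
    have large: "real (card (D b)) \<le> 2 * real X * real h * (1 / (real b)\<^sup>2)" if "b \<ge> 1" for b
    proof -
      have "card (T b) \<le> card {1..N b}" unfolding T_def by (intro card_mono) auto
      then have "card (D b) \<le> N b" using DT[OF that] by simp
      then have "real (card (D b)) \<le> real (N b)" by simp
      also note Nle[of b]
      finally show ?thesis by simp
    qed
    have small: "real (card (D b)) \<le> 8 * C * real h * real X / (ln (real X))\<^sup>2 * K b" if b: "b \<ge> 1" "b \<le> S" for b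
    proof -
      define g where "g = gcd b h"
      define b' where "b' = b div g"
      define h' where "h' = h div g"
      have g: "g > 0" using h by (simp add: g_def)
      have bg: "b = g * b'" "h = g * h'" unfolding b'_def h'_def g_def by simp_all
      have eqs: "(b + h) div gcd b h = b' + h'" "b div gcd b h = b'"
        unfolding g_def[symmetric] using g by (simp_all add: bg flip: distrib_left)
      have pos: "b' > 0" "h' > 0" using b h bg by (auto intro!: Nat.gr0I)
      have le: "b' \<le> b" "h' \<le> h" unfolding b'_def h'_def by (rule div_le_dividend)+
      have "sqrt (real X) * sqrt (real X) = real X" by simp
      have "real S ^ 4 \<le> real X" using S(2) by (metis of_nat_le_iff of_nat_power)
      then have "(real S ^ 2)\<^sup>2 \<le> real X" by (simp flip: power_mult)
      then have S2: "real S ^ 2 \<le> sqrt (real X)" by (rule real_le_rsqrt)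
      have sqrtX: "sqrt (real X) \<ge> 1" using X2 by simp
      have "b\<^sup>2 > 0" using b by simp
      have "(real b)\<^sup>2 \<le> real S ^ 2" using b by (intro power_mono) auto
      then have "(real b)\<^sup>2 \<le> sqrt (real X)" using S2 by linarith
      then have "2 * real X / sqrt (real X) \<le> 2 * real X / (real b)\<^sup>2"
        using b X2 by (intro divide_left_mono) (auto intro!: mult_pos_pos)
      also have "2 * real X / sqrt (real X) = 2 * sqrt (real X)" 
        using real_div_sqrt[of "real X"] by (metis of_nat_0_le_iff times_divide_eq_right)
      also have "2 * real X / (real b)\<^sup>2 \<le> 2 * real X * real h / (real b)\<^sup>2"
        using h mult_left_mono[of 1 "real h" "2 * real X"] by (intro divide_right_mono) auto
      \<comment> \<open>The spare factor 2 absorbs the rounding in \<open>N b\<close>, because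
        \<open>sqrt (real X) \<ge> 1\<close>.\<close>
      finally have "2 * sqrt (real X) \<le> real (2 * X * h) / real (b\<^sup>2)" by simp
      also have "real (2 * X * h) / real (b\<^sup>2) < real (N b) + 1"
      proof -
        have "2 * X * h < b\<^sup>2 * (N b + 1)"
          unfolding N_def using \<open>b\<^sup>2 > 0\<close> dividend_less_times_div[of "b\<^sup>2" "2 * X * h"] by simp
        then have "real (2 * X * h) < real (b\<^sup>2) * (real (N b) + 1)"
          by (metis of_nat_1 of_nat_add of_nat_less_iff of_nat_mult)
        moreover have "real (b\<^sup>2) > 0" using \<open>b\<^sup>2 > 0\<close> by (simp only: of_nat_0_less_iff)
        ultimately show ?thesis by (simp only: pos_divide_less_eq mult.commute)
      qed
      finally have Nge: "real (N b) \<ge> sqrt (real X)" using sqrtX by linarith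
      have "real N0 ^ 2 \<le> real X" using X by (metis add_leD1 of_nat_le_iff of_nat_power)
      then have "real N0 \<le> sqrt (real X)" by (rule real_le_rsqrt)
      then have "N b \<ge> N0" using Nge by linarith
      have lnN: "ln (real (N b)) \<ge> ln (real X) / 2"
      proof -
        have "ln (real X) / 2 = ln (sqrt (real X))" using X2 by (simp add: ln_sqrt)
        also have "\<dots> \<le> ln (real (N b))" using Nge sqrtX by (intro ln_mono) auto
        finally show ?thesis .
      qed
      define M where "M = 2 * ((b' + h') * b' * (b' + h' - b'))"
      have "M > 0" using pos by (simp add: M_def)
      have "(b' + h') * b' * h' \<le> (b + h) * b * h" using le by (intro mult_mono) auto
      also have "b + h \<le> 2 * b * h"
      proof -
        have "b * 1 \<le> b * h" "1 * h \<le> b * h" using b h by (intro mult_mono; simp)+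
        then show ?thesis by linarith
      qed
      then have "(b + h) * b * h \<le> (2 * b * h) * b * h" by (intro mult_mono) auto
      finally have "2 * ((b' + h') * b' * h') \<le> 2 * ((2 * b * h) * b * h)" by (intro mult_left_mono) auto
      then have "M \<le> 2 * ((2 * b * h) * b * h)" by (simp only: M_def diff_add_inverse)
      then have "real M \<le> real (2 * ((2 * b * h) * b * h))" by (simp only: of_nat_le_iff)
      also have "\<dots> = c * (real b)\<^sup>2" by (simp add: c_def power2_eq_square)
      finally have lnM1: "ln (real M) \<le> ln (c * (real b)\<^sup>2)" using \<open>M > 0\<close> by (intro ln_mono) auto
      have lnM0: "ln (real M) \<ge> 0" using \<open>M > 0\<close> by (intro ln_ge_zero) simp
      have "real (card (D b)) \<le> real (card (T b))" using DT[OF b(1)] by simp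
      also have "\<dots> \<le> C * (1 + ln (real M))\<^sup>2 * real (N b) / (ln (real (N b)))\<^sup>2"
        unfolding T_def eqs M_def using \<open>N b \<ge> N0\<close> pos by (intro sieve) auto
      also have "\<dots> \<le> C * (1 + ln (c * (real b)\<^sup>2))\<^sup>2 * (2 * real X * real h / (real b)\<^sup>2) / (ln (real X) / 2)\<^sup>2"
        using lnM1 lnM0 Nle[of b] lnN lnX C
        by (intro frac_le mult_mono power_mono mult_nonneg_nonneg) auto
      also have "\<dots> = 8 * C * real h * real X / (ln (real X))\<^sup>2 * K b"
        by (simp add: K_def power_divide mult_ac)
      finally show ?thesis .
    qed
    have "card (\<Union>b\<in>{1..X}. D b) \<le> (\<Sum>b=1..X. card (D b))" by (rule card_UN_le) simp
    also have "\<dots> \<le> (\<Sum>b\<in>{1..S} \<union> {S+1..X}. card (D b))" by (intro sum_mono2) auto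
    also have "\<dots> = (\<Sum>b=1..S. card (D b)) + (\<Sum>b=S+1..X. card (D b))"
      by (intro sum.union_disjoint) auto
    finally have "real (card (\<Union>b\<in>{1..X}. D b)) \<le> (\<Sum>b=1..S. real (card (D b))) + (\<Sum>b=S+1..X. real (card (D b)))"
      by (simp only: of_nat_le_iff flip: of_nat_sum of_nat_add)
    also have "(\<Sum>b=1..S. real (card (D b))) \<le> (\<Sum>b=1..S. 8 * C * real h * real X / (ln (real X))\<^sup>2 * K b)"
      using small by (intro sum_mono) auto
    also have "\<dots> = 8 * C * real h * real X / (ln (real X))\<^sup>2 * (\<Sum>b=1..S. K b)" by (simp only: sum_distrib_left)
    also have "\<dots> \<le> 8 * C * real h * real X / (ln (real X))\<^sup>2 * suminf K"
      using C K0 sumK by (intro mult_left_mono sum_le_suminf) auto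
    also have "(\<Sum>b=S+1..X. real (card (D b))) \<le> (\<Sum>b=S+1..X. 2 * real X * real h * (1 / (real b)\<^sup>2))"
      using large by (intro sum_mono) auto
    also have "\<dots> = 2 * real X * real h * (\<Sum>b=S+1..X. 1 / (real b)\<^sup>2)" by (simp only: sum_distrib_left)
    also have "\<dots> \<le> 2 * real X * real h * (2 / real S)"
    proof (intro mult_left_mono)
      have "(\<Sum>b=S+1..X. 1 / (real b)\<^sup>2) \<le> 2 / real (S + 1)" by (rule sum_inverse_squares_le) simp
      also have "\<dots> \<le> 2 / real S" using S by (intro divide_left_mono) auto
      finally show "(\<Sum>b=S+1..X. 1 / (real b)\<^sup>2) \<le> 2 / real S" .
    qed auto
    finally show ?thesis unfolding D_def by (simp add: mult_ac)
  qed
  show ?thesis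
    by (rule exI[of _ "8 * C * real h * suminf K"], rule exI[of _ "N0\<^sup>2 + 2"], intro allI impI, rule bound)
qed

section \<open>Collecting the exceptional sets and choosing the parameters\<close>

lemma card_shift_le:
  fixes P :: "nat \<Rightarrow> bool"
  shows "card {n \<in> {1..X}. P (n + h)} \<le> card {m \<in> {1..X + h}. P m}"
  by (rule card_inj_on_le[of "\<lambda>n. n + h"]) auto

text \<open>The summands are, in order: \<open>n \<le> X / S\<close>; too many primes in
  \<open>n\<close>, then in \<open>n + h\<close>; a large square dividing \<open>n\<close>, then
  \<open>n + h\<close>; \<open>p * q \<le> X * S\<^sup>2\<close>; the nondegenerate pairs; the
  degenerate family. The \<open>+ 1\<close> in the exponent is spent on the first:
  \<open>n > X / S\<close> then yields \<open>n > S ^ (6 * W\<^sup>2)\<close>.\<close>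

lemma card_solutions_le:
  fixes X S W h k :: nat
  assumes h: "h \<ge> 1" and S: "S > h" and W: "W \<ge> 1" and X: "S ^ (6 * W\<^sup>2 + 1) \<le> X"
  shows "real (card {n \<in> {1..X}. divisor_sum (n + h) = k * divisor_sum n})
    \<le> real X / real S + real X * (1 + ln (real X)) / 2 ^ W + real (X + h) * (1 + ln (real (X + h))) / 2 ^ W
      + 2 * real X / real S + 2 * real (X + h) / real S
      + 8 * (real X + real (X * S\<^sup>2)) * (1 + ln (real (X + h + 1)))\<^sup>2 / real (S ^ 6)
      + real ((X + h) div S\<^sup>2) * (1 + ln (real ((X + h) div S\<^sup>2)))
      + real (card (\<Union>b\<in>{1..X}. {n \<in> {1..X}. \<exists>p q. prime p \<and> prime q \<and> n = (b + h) * p \<and> n + h = b * q}))"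
proof -
  define A where "A = {n \<in> {1..X}. divisor_sum (n + h) = k * divisor_sum n}"
  define B1 where "B1 = {1..X div S}"
  define B2 where "B2 = {n \<in> {1..X}. card (prime_factors n) > W}"
  define B3 where "B3 = {n \<in> {1..X}. card (prime_factors (n + h)) > W}"
  define B4 where "B4 = {n \<in> {1..X}. \<exists>s\<ge>S. s\<^sup>2 dvd n}"
  define B5 where "B5 = {n \<in> {1..X}. \<exists>s\<ge>S. s\<^sup>2 dvd n + h}"
  define B6 where "B6 = {n \<in> {1..X}. \<exists>p q d. prime p \<and> prime q \<and> S ^ 6 < d \<and> d dvd p + 1 \<and> d dvd q + 1
      \<and> p dvd n \<and> q dvd n + h \<and> p * q \<le> X * S\<^sup>2}"
  define B7 where "B7 = {n \<in> {1..X}. divisor_sum (n + h) = k * divisor_sum n \<and>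
      (\<exists>p q a b. prime p \<and> prime q \<and> n = a * p \<and> n + h = b * q \<and> \<not> p dvd a \<and> \<not> q dvd b
        \<and> a \<noteq> b + h \<and> X * S\<^sup>2 < p * q)}"
  define B8 where "B8 = (\<Union>b\<in>{1..X}. {n \<in> {1..X}. \<exists>p q. prime p \<and> prime q \<and> n = (b + h) * p \<and> n + h = b * q})"
  have S1: "S \<ge> 1" using S by simp
  have "1 \<le> S ^ (6 * W\<^sup>2 + 1)" using S1 by simp
  then have X1: "X \<ge> 1" using X by linarith
  have cover: "A \<subseteq> B1 \<union> B2 \<union> B3 \<union> B4 \<union> B5 \<union> B6 \<union> B7 \<union> B8"
  proof
    fix n assume "n \<in> A"
    then have n: "n \<in> {1..X}" and eq: "divisor_sum (n + h) = k * divisor_sum n" by (simp_all add: A_def)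
    show "n \<in> B1 \<union> B2 \<union> B3 \<union> B4 \<union> B5 \<union> B6 \<union> B7 \<union> B8"
    proof (cases "n \<in> B1 \<or> n \<in> B2 \<or> n \<in> B3 \<or> n \<in> B4 \<or> n \<in> B5")
      case False
      then have "\<not> n \<le> X div S" using n by (simp add: B1_def)
      then have "X < n * S" using S1 by (simp add: less_eq_div_iff_mult_less_eq not_le)
      have "S ^ (6 * W\<^sup>2) * S = S ^ (6 * W\<^sup>2 + 1)" by simp
      also note X
      also note \<open>X < n * S\<close>
      finally have large: "S ^ (6 * W\<^sup>2) < n" by (simp only: mult_less_cancel2)
      have omega: "card (prime_factors n) \<le> W" "card (prime_factors (n + h)) \<le> W"
        using False n by (simp_all add: B2_def B3_def)
      have nosq: "\<not> s\<^sup>2 dvd n" "\<not> s\<^sup>2 dvd n + h" if "S \<le> s" for s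
        using False n that by (auto simp: B4_def B5_def)
      have "n + h \<ge> 1" using h by simp
      have "\<exists>p q d. prime p \<and> prime q \<and> S ^ 6 < d \<and> d dvd p + 1 \<and> d dvd q + 1
          \<and> p dvd n \<and> \<not> p\<^sup>2 dvd n \<and> q dvd n + h \<and> \<not> q\<^sup>2 dvd n + h"
        by (rule common_divisor_of_shifted_primes[OF eq \<open>n + h \<ge> 1\<close> S1 W omega large]) (rule nosq; assumption)+
      then obtain p q d where pq: "prime p" "prime q" "S ^ 6 < d" "d dvd p + 1" "d dvd q + 1"
        "p dvd n" "\<not> p\<^sup>2 dvd n" "q dvd n + h" "\<not> q\<^sup>2 dvd n + h" by (elim exE conjE)
      show ?thesis
      proof (cases "p * q \<le> X * S\<^sup>2")
        case True
        then have "\<exists>p q d. prime p \<and> prime q \<and> S ^ 6 < d \<and> d dvd p + 1 \<and> d dvd q + 1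
            \<and> p dvd n \<and> q dvd n + h \<and> p * q \<le> X * S\<^sup>2"
          using pq by (intro exI conjI)
        then have "n \<in> B6" unfolding B6_def using n by simp
        then show ?thesis by simp
      next
        case False
        obtain a where a: "n = a * p" using pq(6) by (metis dvd_def mult.commute)
        obtain b where b: "n + h = b * q" using pq(8) by (metis dvd_def mult.commute)
        have na: "\<not> p dvd a" using pq(7) unfolding a power2_eq_square by (metis dvd_refl mult_dvd_mono)
        have nb: "\<not> q dvd b" using pq(9) unfolding b power2_eq_square by (metis dvd_refl mult_dvd_mono)
        show ?thesis
        proof (cases "a = b + h")
          case True
          have "b \<ge> 1" using nb by (auto simp: Suc_le_eq intro!: Nat.gr0I)
          moreover have "a * 1 \<le> n" unfolding a using prime_ge_1_nat[OF pq(1)] by (intro mult_left_mono) auto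
          moreover have "n \<le> X" using n by simp
          ultimately have "b \<ge> 1" "b \<le> X" using True by linarith+
          then have bX: "b \<in> {1..X}" by simp
          have "\<exists>p q. prime p \<and> prime q \<and> n = (b + h) * p \<and> n + h = b * q"
            using pq(1,2) a b unfolding True by (intro exI conjI)
          then have "n \<in> {n \<in> {1..X}. \<exists>p q. prime p \<and> prime q \<and> n = (b + h) * p \<and> n + h = b * q}"
            using n by simp
          then have "n \<in> B8" unfolding B8_def using bX by (rule UN_I[rotated])
          then show ?thesis by simp
        next
          case ne: False
          have "X * S\<^sup>2 < p * q" using False by simp
          then have "\<exists>p q a b. prime p \<and> prime q \<and> n = a * p \<and> n + h = b * q \<and> \<not> p dvd a \<and> \<not> q dvd b
              \<and> a \<noteq> b + h \<and> X * S\<^sup>2 < p * q"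
            using pq(1,2) a b na nb ne by (intro exI conjI)
          then have "n \<in> B7" unfolding B7_def using n eq by simp
          then show ?thesis by simp
        qed
      qed
    qed auto
  qed
  have fin: "finite (B1 \<union> B2 \<union> B3 \<union> B4 \<union> B5 \<union> B6 \<union> B7 \<union> B8)"
    by (simp add: B1_def B2_def B3_def B4_def B5_def B6_def B7_def B8_def)
  have "card A \<le> card (B1 \<union> B2 \<union> B3 \<union> B4 \<union> B5 \<union> B6 \<union> B7 \<union> B8)"
    using fin cover by (rule card_mono)
  also have "\<dots> \<le> card B1 + card B2 + card B3 + card B4 + card B5 + card B6 + card B7 + card B8"
    by (intro order.trans[OF card_Un_le] add_right_mono order.refl)
  finally have "real (card A) \<le> real (card B1) + real (card B2) + real (card B3) + real (card B4)
      + real (card B5) + real (card B6) + real (card B7) + real (card B8)"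
    by (simp only: of_nat_le_iff flip: of_nat_add)
  moreover have "real (card B1) \<le> real X / real S"
    unfolding B1_def using of_nat_div_le_of_nat[of X S] by simp
  moreover have "real (card B2) \<le> real X * (1 + ln (real X)) / 2 ^ W"
    unfolding B2_def by (rule card_many_prime_factors_le)
  moreover have "real (card B3) \<le> real (X + h) * (1 + ln (real (X + h))) / 2 ^ W"
  proof -
    have "real (card B3) \<le> real (card {m \<in> {1..X + h}. card (prime_factors m) > W})"
      unfolding B3_def of_nat_le_iff by (rule card_shift_le)
    also have "\<dots> \<le> real (X + h) * (1 + ln (real (X + h))) / 2 ^ W" by (rule card_many_prime_factors_le)
    finally show ?thesis .
  qed
  moreover have "real (card B4) \<le> 2 * real X / real S"
    unfolding B4_def using S1 by (rule card_large_square_divisor_le)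
  moreover have "real (card B5) \<le> 2 * real (X + h) / real S"
  proof -
    have "real (card B5) \<le> real (card {m \<in> {1..X + h}. \<exists>s\<ge>S. s\<^sup>2 dvd m})"
      unfolding B5_def of_nat_le_iff by (rule card_shift_le)
    also have "\<dots> \<le> 2 * real (X + h) / real S" using S1 by (rule card_large_square_divisor_le)
    finally show ?thesis .
  qed
  moreover have "real (card B6) \<le> 8 * (real X + real (X * S\<^sup>2)) * (1 + ln (real (X + h + 1)))\<^sup>2 / real (S ^ 6)"
  proof -
    have "S \<le> S ^ 6" using S1 by (intro self_le_power) auto
    then have "h < S ^ 6" using S by linarith
    then show ?thesis unfolding B6_def using h by (rule card_common_shifted_divisor_le)
  qed
  moreover have "real (card B7) \<le> real ((X + h) div S\<^sup>2) * (1 + ln (real ((X + h) div S\<^sup>2)))"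
    unfolding B7_def using S1 X1 by (intro card_nondegenerate_le) auto
  ultimately show ?thesis unfolding A_def B8_def by linarith
qed

text \<open>\<open>S\<close> and \<open>W\<close> are the ceilings of \<open>L\<^sup>2\<close> and
  \<open>3 * log 2 L\<close> for \<open>L = ln X\<close>, the least integers with
  \<open>L\<^sup>2 \<le> S\<close> and \<open>L ^ 3 \<le> 2 ^ W\<close>. The cube beats the
  logarithm lost in counting divisors. \<open>X0\<close> is the threshold of the degenerate
  bound.\<close>

lemma eventually_parameters:
  fixes h X0 :: nat
  shows "\<exists>X1. \<forall>X\<ge>X1. \<exists>S W. h < S \<and> 1 \<le> W \<and> S ^ (6 * W\<^sup>2 + 1) \<le> X \<and> S ^ 4 \<le> X
    \<and> (ln (real X))\<^sup>2 \<le> real S \<and> ln (real X) ^ 3 \<le> 2 ^ W \<and> 2 \<le> ln (real X) \<and> h + 1 \<le> X \<and> X0 \<le> X"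
proof -
  have "\<forall>\<^sub>F x::real in at_top. (6 * (3 * log 2 (ln x) + 1)\<^sup>2 + 1) * ln ((ln x)\<^sup>2 + 1) \<le> ln x" by real_asymp
  moreover have "\<forall>\<^sub>F x::real in at_top. 4 * ln ((ln x)\<^sup>2 + 1) \<le> ln x" by real_asymp
  moreover have "\<forall>\<^sub>F x::real in at_top. real h < (ln x)\<^sup>2" by real_asymp
  moreover have "\<forall>\<^sub>F x::real in at_top. ln x \<ge> 2" by real_asymp
  moreover have "\<forall>\<^sub>F x::real in at_top. x \<ge> real (h + 1 + X0)" by (rule eventually_ge_at_top)
  ultimately have "\<forall>\<^sub>F x::real in at_top. (6 * (3 * log 2 (ln x) + 1)\<^sup>2 + 1) * ln ((ln x)\<^sup>2 + 1) \<le> ln x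
     \<and> 4 * ln ((ln x)\<^sup>2 + 1) \<le> ln x \<and> real h < (ln x)\<^sup>2 \<and> ln x \<ge> 2 \<and> x \<ge> real (h + 1 + X0)"
    by eventually_elim simp
  from eventually_compose_filterlim[OF this filterlim_real_sequentially]
  obtain X1 where X1: "\<And>X. X \<ge> X1 \<Longrightarrow>
     (6 * (3 * log 2 (ln (real X)) + 1)\<^sup>2 + 1) * ln ((ln (real X))\<^sup>2 + 1) \<le> ln (real X)
     \<and> 4 * ln ((ln (real X))\<^sup>2 + 1) \<le> ln (real X) \<and> real h < (ln (real X))\<^sup>2 \<and> ln (real X) \<ge> 2
     \<and> real X \<ge> real (h + 1 + X0)"
    unfolding eventually_sequentially by blast
  have "\<exists>S W. h < S \<and> 1 \<le> W \<and> S ^ (6 * W\<^sup>2 + 1) \<le> X \<and> S ^ 4 \<le> X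
    \<and> (ln (real X))\<^sup>2 \<le> real S \<and> ln (real X) ^ 3 \<le> 2 ^ W \<and> 2 \<le> ln (real X) \<and> h + 1 \<le> X \<and> X0 \<le> X"
    if X: "X \<ge> X1" for X
  proof -
    define L where "L = ln (real X)"
    define S where "S = nat \<lceil>L\<^sup>2\<rceil>"
    define W where "W = nat \<lceil>3 * log 2 L\<rceil>"
    have L: "(6 * (3 * log 2 L + 1)\<^sup>2 + 1) * ln (L\<^sup>2 + 1) \<le> L" "4 * ln (L\<^sup>2 + 1) \<le> L"
      "real h < L\<^sup>2" "L \<ge> 2" and Xh: "real X \<ge> real (h + 1 + X0)"
      using X1[OF X] unfolding L_def by blast+
    have Xpos: "real X > 0" using Xh by simp
    have log1: "log 2 L \<ge> 1" using L(4) by (simp add: le_log_iff)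
    have S: "real S \<ge> L\<^sup>2" "real S \<le> L\<^sup>2 + 1"
      unfolding S_def using of_nat_ceiling[of "L\<^sup>2"] of_int_ceiling_le_add_one[of "L\<^sup>2"] by simp_all
    have W: "real W \<ge> 3 * log 2 L" "real W \<le> 3 * log 2 L + 1"
      unfolding W_def using of_nat_ceiling[of "3 * log 2 L"] of_int_ceiling_le_add_one[of "3 * log 2 L"] log1 by simp_all
    have S_pos: "real S > 0" using S(1) L(4) by (smt (verit) zero_less_power)
    have power_le: "S ^ m \<le> X" if "real m * ln (L\<^sup>2 + 1) \<le> L" for m
    proof -
      have "ln (real S ^ m) = real m * ln (real S)" using S_pos by (simp add: ln_realpow)
      also have "\<dots> \<le> real m * ln (L\<^sup>2 + 1)" using S S_pos by (intro mult_left_mono ln_mono) auto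
      also have "\<dots> \<le> ln (real X)" using that by (simp add: L_def)
      finally have "real S ^ m \<le> real X" using S_pos Xpos by (subst (asm) ln_le_cancel_iff) auto
      then show ?thesis by (simp only: of_nat_le_iff flip: of_nat_power)
    qed
    have lnS: "ln (L\<^sup>2 + 1) \<ge> 0" by simp
    have "real (6 * W\<^sup>2 + 1) = 6 * (real W)\<^sup>2 + 1" by simp
    also have "\<dots> \<le> 6 * (3 * log 2 L + 1)\<^sup>2 + 1" using W(2) by (intro add_mono mult_left_mono power_mono) auto
    finally have "real (6 * W\<^sup>2 + 1) * ln (L\<^sup>2 + 1) \<le> (6 * (3 * log 2 L + 1)\<^sup>2 + 1) * ln (L\<^sup>2 + 1)"
      using lnS by (rule mult_right_mono)
    also note L(1)
    finally have 1: "S ^ (6 * W\<^sup>2 + 1) \<le> X" by (rule power_le)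
    have 2: "S ^ 4 \<le> X" using L(2) by (intro power_le) simp
    have "L ^ 3 = 2 powr (3 * log 2 L)" using L(4) by (simp add: powr_powr[symmetric] mult.commute[of 3] powr_numeral)
    also have "\<dots> \<le> 2 powr real W" using W(1) by simp
    also have "\<dots> = 2 ^ W" by (simp add: powr_realpow)
    finally have 3: "L ^ 3 \<le> 2 ^ W" .
    have "real h < real S" using L(3) S(1) by linarith
    then have 4: "h < S" by simp
    have "real W \<ge> 1" using W(1) log1 by linarith
    then have 5: "1 \<le> W" by simp
    have 6: "h + 1 \<le> X" "X0 \<le> X" using Xh by linarith+
    show ?thesis
      unfolding L_def[symmetric] using 1 2 3 4 5 6 S(1) L(4) by (intro exI conjI)
  qed
  then show ?thesis by (intro exI[of _ X1]) simp
qed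

lemma card_solutions_asymp:
  fixes h :: nat
  assumes h: "h \<ge> 1"
  shows "\<exists>C X0. \<forall>X\<ge>X0. \<forall>k. real (card {n \<in> {1..X}. divisor_sum (n + h) = k * divisor_sum n})
    \<le> C * (real X / (ln (real X))\<^sup>2)"
proof -
  obtain C X0 where deg: "\<And>X S. X0 \<le> X \<Longrightarrow> 1 \<le> S \<Longrightarrow> S ^ 4 \<le> X \<Longrightarrow>
    real (card (\<Union>b\<in>{1..X}. {n \<in> {1..X}. \<exists>p q. prime p \<and> prime q \<and> n = (b + h) * p \<and> n + h = b * q}))
      \<le> C * real X / (ln (real X))\<^sup>2 + 4 * real X * real h / real S"
    using card_degenerate_union_le[OF h] by blast
  obtain X1 where X1: "\<And>X. X \<ge> X1 \<Longrightarrow> \<exists>S W. h < S \<and> 1 \<le> W \<and> S ^ (6 * W\<^sup>2 + 1) \<le> X \<and> S ^ 4 \<le> X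
    \<and> (ln (real X))\<^sup>2 \<le> real S \<and> ln (real X) ^ 3 \<le> 2 ^ W \<and> 2 \<le> ln (real X) \<and> h + 1 \<le> X \<and> X0 \<le> X"
    using eventually_parameters[of h X0] by blast
  \<comment> \<open>In units of \<open>X / (ln X)\<^sup>2\<close> the first seven groups contribute
    \<open>1 + 3 + 6 + 2 + 4 + 144 + 6 = 166\<close>; the degenerate family adds
    \<open>C + 4 * h\<close>.\<close>
  have "real (card {n \<in> {1..X}. divisor_sum (n + h) = k * divisor_sum n})
    \<le> (C + 4 * real h + 166) * (real X / (ln (real X))\<^sup>2)" if X: "X \<ge> X1" for X k
  proof -
    define L where "L = ln (real X)"
    obtain S W where S: "h < S" "1 \<le> W" "S ^ (6 * W\<^sup>2 + 1) \<le> X" "S ^ 4 \<le> X" "L\<^sup>2 \<le> real S"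
      "L ^ 3 \<le> 2 ^ W" "2 \<le> L" "h + 1 \<le> X" "X0 \<le> X"
      using X1[OF X] unfolding L_def by (elim exE conjE)
    define Q where "Q = real X / L\<^sup>2"
    have L2: "L\<^sup>2 > 0" using S(7) by simp
    have Xpos: "real X \<ge> 2" using S(8) h by simp
    have S_pos: "real S \<ge> 1" using S(1) by simp
    have "1 \<le> S" using S(1) by simp
    have divS: "real X / real S \<le> Q"
      unfolding Q_def using S(5) L2 S_pos by (intro divide_left_mono mult_pos_pos) auto
    have Xh: "real (X + h) \<le> 2 * real X" using S(8) by simp
    have "real (X + h + 1) \<le> real X * real X"
    proof -
      have "real (X + h + 1) \<le> 2 * real X" using S(8) by simp
      also have "\<dots> \<le> real X * real X" using Xpos by (intro mult_right_mono) auto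
      finally show ?thesis .
    qed
    then have "ln (real (X + h + 1)) \<le> ln (real X * real X)" by (intro ln_mono) auto
    also have "\<dots> = 2 * L" unfolding L_def using Xpos by (simp add: ln_mult)
    finally have ln1: "1 + ln (real (X + h + 1)) \<le> 3 * L" using S(7) by linarith
    have ln_le: "1 + ln (real m) \<le> 3 * L" if "m \<le> X + h" for m
    proof (cases "m = 0")
      case True
      then show ?thesis using S(7) by simp
    next
      case False
      then have "ln (real m) \<le> ln (real (X + h + 1))" using that by (intro ln_mono) auto
      then show ?thesis using ln1 by linarith
    qed
    have W_le: "Y * (1 + ln (real m)) / 2 ^ W \<le> 3 * c * Q"
      if "0 \<le> Y" "Y \<le> c * real X" "m \<le> X + h" for Y c m
    proof -
      have "Y * (1 + ln (real m)) / 2 ^ W \<le> Y * (3 * L) / 2 ^ W"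
        using ln_le[OF that(3)] that(1) by (intro divide_right_mono mult_left_mono) auto
      also have "\<dots> \<le> Y * (3 * L) / L ^ 3"
        using S(6,7) that(1) by (intro divide_left_mono mult_nonneg_nonneg mult_pos_pos) auto
      also have "\<dots> = 3 * Y / L\<^sup>2" using S(7) by (simp add: power3_eq_cube power2_eq_square)
      also have "\<dots> \<le> 3 * (c * real X) / L\<^sup>2" using that(2) by (intro divide_right_mono mult_left_mono) auto
      finally show ?thesis by (simp add: Q_def)
    qed
    have t2: "real X * (1 + ln (real X)) / 2 ^ W \<le> 3 * 1 * Q"
      by (intro W_le) auto
    have t3: "real (X + h) * (1 + ln (real (X + h))) / 2 ^ W \<le> 3 * 2 * Q"
      using Xh by (intro W_le) auto
    have t4: "2 * real X / real S \<le> 2 * Q" using divS by simp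
    have "2 * real (X + h) / real S \<le> 2 * (2 * real X) / real S"
      using Xh by (intro divide_right_mono mult_left_mono) auto
    then have t5: "2 * real (X + h) / real S \<le> 4 * Q" using divS by simp
    have S4: "L ^ 4 \<le> real S ^ 2"
    proof -
      have "(L\<^sup>2)\<^sup>2 \<le> (real S)\<^sup>2" using S(5) by (intro power_mono) auto
      then show ?thesis by (simp flip: power_mult)
    qed
    have t6: "8 * (real X + real (X * S\<^sup>2)) * (1 + ln (real (X + h + 1)))\<^sup>2 / real (S ^ 6) \<le> 144 * Q"
    proof -
      have "real X * 1 \<le> real X * real S ^ 2" using S_pos by (intro mult_left_mono one_le_power) auto
      then have "8 * (real X + real (X * S\<^sup>2)) \<le> 16 * (real X * real S ^ 2)" by simp
      moreover have "(1 + ln (real (X + h + 1)))\<^sup>2 \<le> (3 * L)\<^sup>2" using ln1 by (intro power_mono) auto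
      ultimately have "8 * (real X + real (X * S\<^sup>2)) * (1 + ln (real (X + h + 1)))\<^sup>2
          \<le> 16 * (real X * real S ^ 2) * (3 * L)\<^sup>2"
        by (rule mult_mono) auto
      then have "8 * (real X + real (X * S\<^sup>2)) * (1 + ln (real (X + h + 1)))\<^sup>2 / real (S ^ 6)
          \<le> 16 * (real X * real S ^ 2) * (3 * L)\<^sup>2 / real (S ^ 6)"
        by (rule divide_right_mono) simp
      also have "\<dots> = 144 * (real X * L\<^sup>2) / (real S ^ 2)\<^sup>2"
      proof -
        have "16 * (x * s\<^sup>2) * (3 * l)\<^sup>2 / s ^ 6 = 144 * (x * l\<^sup>2) / (s\<^sup>2)\<^sup>2" if "s > 0" for x s l :: real
          using that by (simp add: field_simps power_mult_distrib flip: power_mult power_add)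
        from this[of "real S"] show ?thesis using S_pos by simp
      qed
      also have "\<dots> \<le> 144 * (real X * L\<^sup>2) / (L ^ 4)\<^sup>2"
        using S4 S(7) S_pos by (intro divide_left_mono power_mono mult_pos_pos) auto
      also have "\<dots> \<le> 144 * (real X * L\<^sup>2) / L ^ 4"
      proof (intro divide_left_mono)
        have "L ^ 4 * 1 \<le> L ^ 4 * L ^ 4" using S(7) by (intro mult_left_mono one_le_power) auto
        then show "L ^ 4 \<le> (L ^ 4)\<^sup>2" by (simp add: power2_eq_square)
      qed (use S(7) in auto)
      also have "\<dots> = 144 * Q"
        using S(7) by (simp add: Q_def field_simps flip: power_add)
      finally show ?thesis .
    qed
    have t7: "real ((X + h) div S\<^sup>2) * (1 + ln (real ((X + h) div S\<^sup>2))) \<le> 6 * Q"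
    proof -
      have "(X + h) div S\<^sup>2 \<le> X + h" by (rule div_le_dividend)
      then have "real ((X + h) div S\<^sup>2) * (1 + ln (real ((X + h) div S\<^sup>2))) \<le> real ((X + h) div S\<^sup>2) * (3 * L)"
        by (intro mult_left_mono ln_le) auto
      also have "\<dots> \<le> (real (X + h) / real (S\<^sup>2)) * (3 * L)"
        using S(7) by (intro mult_right_mono of_nat_div_le_of_nat) auto
      also have "\<dots> \<le> (2 * real X / real S ^ 2) * (3 * L)"
        using S(7) Xh by (intro mult_right_mono) (auto intro!: divide_right_mono)
      also have "\<dots> \<le> (2 * real X / L ^ 4) * (3 * L)"
        using S(7) S4 S_pos by (intro mult_right_mono divide_left_mono mult_pos_pos) auto
      also have "\<dots> \<le> (2 * real X / L ^ 4) * (3 * L\<^sup>2)"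
        using S(7) by (intro mult_left_mono) (auto simp: power2_eq_square)
      also have "\<dots> = 6 * Q" using S(7) by (simp add: Q_def field_simps flip: power_add)
      finally show ?thesis .
    qed
    have t8: "C * real X / L\<^sup>2 + 4 * real X * real h / real S \<le> (C + 4 * real h) * Q"
    proof -
      have "4 * real h * (real X / real S) \<le> 4 * real h * Q" using divS by (intro mult_left_mono) auto
      moreover have "C * real X / L\<^sup>2 = C * Q" "4 * real X * real h / real S = 4 * real h * (real X / real S)"
        by (simp_all add: Q_def)
      ultimately show ?thesis unfolding distrib_right by linarith
    qed
    have "real (card {n \<in> {1..X}. divisor_sum (n + h) = k * divisor_sum n}) \<le> (C + 4 * real h + 166) * Q"
      using card_solutions_le[OF h S(1,2,3), of k] divS t2 t3 t4 t5 t6 t7 t8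
        deg[OF S(9) \<open>1 \<le> S\<close> S(4), folded L_def] unfolding distrib_right by linarith
    then show ?thesis by (simp only: Q_def L_def)
  qed
  then show ?thesis by (intro exI[of _ "C + 4 * real h + 166"] exI[of _ X1]) simp
qed

theorem corollary3p9:
  fixes h :: nat
  assumes "h \<ge> 1"
  shows "(\<lambda>x::real. SUP k\<in>{1..}. real (A_count h k x)) \<in> O[at_top](\<lambda>x. x / (ln x)\<^sup>2)"
proof -
  obtain C X0 where C: "\<And>X k. X \<ge> X0 \<Longrightarrow>
      real (card {n \<in> {1..X}. divisor_sum (n + h) = k * divisor_sum n}) \<le> C * (real X / (ln (real X))\<^sup>2)"
    using card_solutions_asymp[OF assms] by blast
  \<comment> \<open>Passing from \<open>x\<close> to its floor at most halves the logarithm, which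
    costs the factor 4.\<close>
  have "\<forall>\<^sub>F x::real in at_top. ln x / 2 \<le> ln (x - 1)" by real_asymp
  moreover have "\<forall>\<^sub>F x::real in at_top. x \<ge> real X0 + 3" by (rule eventually_ge_at_top)
  ultimately have "\<forall>\<^sub>F x in at_top. norm (SUP k\<in>{1..}. real (A_count h k x)) \<le> (4 * \<bar>C\<bar>) * norm (x / (ln x)\<^sup>2)"
  proof eventually_elim
    case (elim x)
    define X where "X = nat \<lfloor>x\<rfloor>"
    have X: "real X \<le> x" "x - 1 \<le> real X" unfolding X_def using elim(2) by linarith+
    have "X \<ge> X0" using X elim by linarith
    have lnx: "ln x > 0" using elim(2) by simp
    have "ln (x - 1) \<le> ln (real X)" using X elim by (intro ln_mono) auto
    then have "ln x / 2 \<le> ln (real X)" using elim(1) by linarith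
    then have "(ln x / 2)\<^sup>2 \<le> (ln (real X))\<^sup>2" using lnx by (intro power_mono) auto
    then have "real X / (ln (real X))\<^sup>2 \<le> x / (ln x / 2)\<^sup>2"
      using X lnx elim(2) by (intro frac_le) auto
    also have "\<dots> = 4 * (x / (ln x)\<^sup>2)" by (simp add: power_divide)
    finally have frac: "real X / (ln (real X))\<^sup>2 \<le> 4 * (x / (ln x)\<^sup>2)" .
    have bound: "real (A_count h k x) \<le> 4 * \<bar>C\<bar> * (x / (ln x)\<^sup>2)" for k
    proof -
      have "A_set h k x \<subseteq> {n \<in> {1..X}. divisor_sum (n + h) = k * divisor_sum n}"
        using A_set_subset[of h k x] by (auto simp: A_set_def X_def)
      then have "A_count h k x \<le> card {n \<in> {1..X}. divisor_sum (n + h) = k * divisor_sum n}"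
        unfolding A_count_def by (intro card_mono) auto
      then have "real (A_count h k x) \<le> real (card {n \<in> {1..X}. divisor_sum (n + h) = k * divisor_sum n})"
        by simp
      also have "\<dots> \<le> C * (real X / (ln (real X))\<^sup>2)" by (rule C) fact
      \<comment> \<open>The sign of \<open>C\<close> is not part of
        \<open>card_solutions_asymp\<close>.\<close>
      also have "\<dots> \<le> \<bar>C\<bar> * (real X / (ln (real X))\<^sup>2)" by (intro mult_right_mono) auto
      also have "\<dots> \<le> \<bar>C\<bar> * (4 * (x / (ln x)\<^sup>2))" using frac by (intro mult_left_mono) auto
      finally show ?thesis by (simp add: mult_ac)
    qed
    have "(SUP k\<in>{1..}. real (A_count h k x)) \<le> 4 * \<bar>C\<bar> * (x / (ln x)\<^sup>2)"
      using bound by (intro cSUP_least) auto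
    \<comment> \<open>On the reals the supremum dominates its members only for a set bounded above;
      \<open>k = 1\<close> serves as the member.\<close>
    moreover have "0 \<le> (SUP k\<in>{1..}. real (A_count h k x))"
      by (rule cSUP_upper2[OF bdd_above_A_count, of 1]) auto
    moreover have "x / (ln x)\<^sup>2 \<ge> 0" using elim(2) by simp
    ultimately show ?case by (simp only: real_norm_def abs_of_nonneg)
  qed
  then show ?thesis by (rule bigoI)
qed

end
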